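(* Let $f(x)=[1+x(1-x)]R(x)-B(x)$. For each integer $n\ge0$ and $x\in(0,1/2]$, let $R_n(x)=\sum_{k=0}^na_kx^k$ and $S_n(x)=\sum_{k=0}^nb_k(1-2x)^{2k}$, and define $$f_n(x)=\frac{f(x)-R_n(x)}{x^{n+1}}\ \ (x\in(0,1/2]),\qquad g_n(x)=\frac{f(x)-S_n(x)}{(1-2x)^{2(n+1)}}\ \ (x\in(0,1/2)).$$ Then the following hold. (1) $f_0$ is strictly increasing and convex from $(0,1/2]$ onto $(a_1,2(b_0-1)]$. Furthermore, for each integer $n\ge1$, $f_{2n-1}$ is strictly increasing and concave from $(0,1/2]$ onto $(a_{2n},A_{2n-1}]$, and $f_{2n}$ is strictly decreasing and convex from $(0,1/2]$ onto $[A_{2n},a_{2n+1})$. In particular, for each integer $n\ge1$ and all $x\in(0,1/2]$, $$\frac{B(x)+R_{2n+2}(x)+A_{2n+2}x^{2n+3}}{1+x(1-x)}\leq R(x)\leq\frac{B(x)+R_{2n+1}(x)+A_{2n+1}x^{2(n+1)}}{1+x(1-x)},$$ $$\frac{B(x)+R_4(x)+A_4x^5}{1+x(1-x)}\leq R(x)\leq\frac{B(x)+R_3(x)+A_3x^4}{1+x(1-x)},$$ with equality in each instance if and only if $x=1/2$. (2) For each integer $n\ge0$, $g_n$ is strictly increasing and concave from $(0,1/2)$ onto $(c_n,b_{n+1})$. Furthermore, for all integers $m,n\ge0$, the function $G_{n,m}(x)=(-1)^{m+1}g_n^{(m)}(x)$ is strictly completely monotonic on $(0,1/2)$. In particular,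 for each integer $n\ge0$ and all $x\in(0,1/2]$, $$\frac{B(x)+S_{n+1}(x)+c_{n+1}(1-2x)^{2n+3}}{1+x(1-x)}\leq R(x)\leq\frac{B(x)+S_{n+1}(x)}{1+x(1-x)},$$ $$\frac{B(x)+S_2(x)+c_2(1-2x)^5}{1+x(1-x)}\leq R(x)\leq\frac{B(x)+S_2(x)}{1+x(1-x)},$$ with equality in each instance if and only if $x=1/2$.
   Context: Let $\psi=\Gamma'/\Gamma$ be the digamma function and $\gamma$ the Euler–Mascheroni constant. For $x\in(0,1)$ put $$R(x)=-2\gamma-\psi(x)-\psi(1-x),\qquad B(x)=\Gamma(x)\Gamma(1-x)=\frac{\pi}{\sin(\pi x)}.$$ (The function $R(x)$ is distinct from the polynomials $R_n(x)$.) $\varphi^{(0)}$ means $\varphi$. Let $\zeta$ be the Riemann zeta function, $\lambda(n)=\sum_{k=0}^\infty (2k+1)^{-n}$ ($n\ge2$), $\eta(n)=\sum_{k=1}^\infty(-1)^{k-1}k^{-n}$ and $\beta(n)=\sum_{k=0}^\infty(-1)^k(2k+1)^{-n}$ ($n\ge 1$). Constants: $a_0=1$, $a_1=-2\eta(2)-1=-1-\pi^2/6$, $a_2=2\zeta(3)$, and for $n\ge3$, $$a_n=[1+(-1)^n][\zeta(n+1)-\zeta(n-1)]+[1-(-1)^n][\zeta(n)-\eta(n+1)];$$ $b_0=5\log2-\pi$, $b_1=-\log2+[35\zeta(3)-\pi^3]/8$, and $b_n=5\lambda(2n+1)-\lambda(2n-1)-4\beta(2n+1)$ for $n\ge2$;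 and for $n\ge0$, $$c_n=1-\sum_{k=0}^nb_k,\qquad A_n=2^{n+1}\Big(b_0-\sum_{k=0}^n2^{-k}a_k\Big).$$ Convention: a smooth function $\varphi$ is called strictly completely monotonic on an interval $I$ if $(-1)^j\varphi^{(j)}(x)>0$ for all integers $j\ge1$ and all $x$ in the interior of $I$. *)

theory Defs
  imports "HOL-Analysis.Analysis"
begin

section \<open>The functions $R$, $B$ and $f$\<close>

definition R_fun :: "real \<Rightarrow> real" where
  "R_fun x = - 2 * euler_mascheroni - Digamma x - Digamma (1 - x)"

definition B_fun :: "real \<Rightarrow> real" where
  "B_fun x = Gamma x * Gamma (1 - x)"

definition f_fun :: "real \<Rightarrow> real" where
  "f_fun x = (1 + x * (1 - x)) * R_fun x - B_fun x"

section \<open>Dirichlet series at integer arguments\<close>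

text \<open>
  The Riemann zeta function is only needed at integers at least 2, where it equals its
  Dirichlet series. As \<^const>\<open>suminf\<close> is unspecified for divergent series, \<open>zeta_nat\<close> and
  \<open>lambda_nat\<close> are meaningful only for arguments at least 2, and \<open>eta_nat\<close> and \<open>beta_nat\<close>
  (conditionally convergent at 1) for arguments at least 1. The summation index of \<open>zeta_nat\<close>
  and \<open>eta_nat\<close> is shifted to start at 0.
\<close>

definition zeta_nat :: "nat \<Rightarrow> real" where
  "zeta_nat n = (\<Sum>k. 1 / real (k + 1) ^ n)"

definition lambda_nat :: "nat \<Rightarrow> real" where
  "lambda_nat n = (\<Sum>k. 1 / real (2 * k + 1) ^ n)"

definition eta_nat :: "nat \<Rightarrow> real" where
  "eta_nat n = (\<Sum>k. (-1) ^ k / real (k + 1) ^ n)"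

definition beta_nat :: "nat \<Rightarrow> real" where
  "beta_nat n = (\<Sum>k. (-1) ^ k / real (2 * k + 1) ^ n)"

section \<open>Coefficients, polynomials and remainders\<close>

definition a_coeff :: "nat \<Rightarrow> real" where
  "a_coeff n =
    (if n = 0 then 1
     else if n = 1 then - 2 * eta_nat 2 - 1
     else if n = 2 then 2 * zeta_nat 3
     else (1 + (-1) ^ n) * (zeta_nat (n + 1) - zeta_nat (n - 1))
        + (1 - (-1) ^ n) * (zeta_nat n - eta_nat (n + 1)))"

definition b_coeff :: "nat \<Rightarrow> real" where
  "b_coeff n =
    (if n = 0 then 5 * ln 2 - pi
     else if n = 1 then - ln 2 + (35 * zeta_nat 3 - pi ^ 3) / 8
     else 5 * lambda_nat (2 * n + 1) - lambda_nat (2 * n - 1) - 4 * beta_nat (2 * n + 1))"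

definition c_const :: "nat \<Rightarrow> real" where
  "c_const n = 1 - (\<Sum>k=0..n. b_coeff k)"

definition A_const :: "nat \<Rightarrow> real" where
  "A_const n = 2 ^ (n + 1) * (b_coeff 0 - (\<Sum>k=0..n. a_coeff k / 2 ^ k))"

definition R_poly :: "nat \<Rightarrow> real \<Rightarrow> real" where
  "R_poly n x = (\<Sum>k=0..n. a_coeff k * x ^ k)"

definition S_poly :: "nat \<Rightarrow> real \<Rightarrow> real" where
  "S_poly n x = (\<Sum>k=0..n. b_coeff k * (1 - 2 * x) ^ (2 * k))"

definition f_rem :: "nat \<Rightarrow> real \<Rightarrow> real" where
  "f_rem n x = (f_fun x - R_poly n x) / x ^ (n + 1)"

definition g_rem :: "nat \<Rightarrow> real \<Rightarrow> real" where
  "g_rem n x = (f_fun x - S_poly n x) / (1 - 2 * x) ^ (2 * (n + 1))"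

section \<open>Strict complete monotonicity\<close>

text \<open>
  \<open>D j\<close> is the \<open>j\<close>-th derivative of \<open>\<phi>\<close> on \<open>I\<close>, one-sided at endpoints belonging to \<open>I\<close>.
\<close>

definition smooth_on_interval :: "real set \<Rightarrow> (real \<Rightarrow> real) \<Rightarrow> bool" where
  "smooth_on_interval I \<phi> \<longleftrightarrow>
    (\<exists>D. D 0 = \<phi> \<and>
      (\<forall>j. \<forall>x\<in>I. (D j has_real_derivative D (Suc j) x) (at x within I)))"

text \<open>
  The sign condition starts at the first derivative: the sign of \<open>\<phi>\<close> itself is not constrained,
  unlike in the usual definition of complete monotonicity.
\<close>

definition strictly_completely_monotonic_on :: "real set \<Rightarrow> (real \<Rightarrow> real) \<Rightarrow> bool" where
  "strictly_completely_monotonic_on I \<phi> \<longleftrightarrow>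
    smooth_on_interval I \<phi> \<and>
    (\<forall>j\<ge>1. \<forall>x\<in>interior I. (-1) ^ j * (deriv ^^ j) \<phi> x > 0)"

definition G_fun :: "nat \<Rightarrow> nat \<Rightarrow> real \<Rightarrow> real" where
  "G_fun n m x = (-1) ^ (m + 1) * (deriv ^^ m) (g_rem n) x"

end

theory Submission
  imports Defs "HOL-Real_Asymp.Real_Asymp"
begin

text \<open>
  By Euler's reflection formulas, \<open>f\<close> is a sum over \<open>k\<close> of the terms
  \<open>(1 + x(1-x) - (-1)^k) (1/(k+x) + 1/(k+1-x)) - 2(1 + x(1-x))/(k+1)\<close>. The factor
  \<open>1 + x(1-x) - (-1)^k\<close> cancels the poles for \<open>k = 0\<close> and \<open>k = 1\<close>, so that only the poles at
  \<open>-k\<close> and \<open>k+1\<close> for \<open>k \<ge> 2\<close> remain, all with residues of the same sign up to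
  reflection in \<open>1/2\<close>. The Taylor remainders at 0 of a single such term have a closed form, which is
  monotone and convex on \<open>[0, 1/2]\<close> since the pole at \<open>-k\<close> dominates the one at \<open>k+1\<close>; these
  properties pass to the sum. At \<open>1/2\<close>, in the variable \<open>t = 1 - 2x\<close>, the term with index \<open>k\<close> is
  a quadratic polynomial plus a negative multiple of \<open>t^4/(u^3 (u^2 - t^2))\<close> with \<open>u = 2k+1 \<ge> 5\<close>,
  so that \<open>f\<close> is a power series in \<open>t^2\<close> whose radius of convergence exceeds 1 and whose
  coefficients from \<open>t^4\<close> on are negative; their sign gives complete monotonicity.
\<close>

section \<open>Partial fractions\<close>

text \<open>The poles for k = 0 and 1 cancel because
  \<open>(k + x) * (k + 1 - x) = k * (k + 1) + x * (1 - x)\<close>: the factor is this product minus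
  \<open>pole_weight k\<close>, which vanishes exactly at 0 and 1. The obstacle is the quadratic
  growth of \<open>pole_weight\<close>: the Taylor remainders of single terms at 0 are of size 1/k
  for the orders 0 and 1, so their series converge only from order 2 on. Order 1 is rescued by
  subtracting the value at 0, which affects neither monotonicity nor convexity. Order 0 needs the
  subtraction of an affine function, which preserves convexity only; that f_0 increases, unlike the
  other even orders, comes from f_0 = a_1 + x f_1 with f_1 positive and increasing.\<close>

lemma Gamma_reflection_real: "Gamma x * Gamma (1 - x) = pi / sin (pi * x)" for x :: real
proof -
  have "complex_of_real (Gamma x * Gamma (1 - x)) = Gamma (of_real x) * Gamma (1 - of_real x)"
    by (metis Gamma_complex_of_real of_real_1 of_real_diff of_real_mult)
  also have "\<dots> = of_real (pi / sin (pi * x))"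
    by (simp add: Gamma_reflection_complex sin_of_real flip: of_real_mult)
  finally show ?thesis
    using of_real_eq_iff by blast
qed

text \<open>Logarithmic derivative of the reflection formula: both sides are differentiated and the
  common factor \<open>pi / sin (pi * x)\<close>, nonzero on (0,1), is cancelled.\<close>

lemma Digamma_reflection_real:
  assumes "0 < x" "x < (1::real)"
  shows "Digamma (1 - x) - Digamma x = pi * cot (pi * x)"
proof -
  have s: "sin (pi * x) > 0"
    using assms by (intro sin_gt_zero) auto
  have n1: "y \<notin> \<int>\<^sub>\<le>\<^sub>0" if "y > 0" for y :: real
    using that nonpos_Ints_nonpos by fastforce
  have "((\<lambda>x. Gamma x * Gamma (1 - x)) has_real_derivative
      Gamma x * Digamma x * Gamma (1 - x) + Gamma (1 - x) * Digamma (1 - x) * (0 - 1) * Gamma x) (at x)"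
    by (rule derivative_eq_intros refl n1 | use assms in simp)+
  moreover have "((\<lambda>x. Gamma x * Gamma (1 - x)) has_real_derivative
      - (pi * (cos (pi * x) * pi)) / (sin (pi * x))\<^sup>2) (at x)"
    \<comment> \<open>Rewriting under the binder is possible because the formula holds at integers
      too, where both sides are 0.\<close>
    unfolding Gamma_reflection_real
    by (rule derivative_eq_intros refl | use s in \<open>simp add: power2_eq_square\<close>)+
  ultimately have "Gamma x * Digamma x * Gamma (1 - x) + Gamma (1 - x) * Digamma (1 - x) * (0 - 1) * Gamma x
      = - (pi * (cos (pi * x) * pi)) / (sin (pi * x))\<^sup>2"
    using DERIV_unique by blast
  then have "(Gamma x * Gamma (1 - x)) * (Digamma (1 - x) - Digamma x)
      = pi * (cos (pi * x) * pi) / (sin (pi * x))\<^sup>2"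
    by (simp add: algebra_simps)
  then have "pi / sin (pi * x) * (Digamma (1 - x) - Digamma x)
      = pi / sin (pi * x) * (pi * cot (pi * x))"
    unfolding Gamma_reflection_real by (simp add: cot_def power2_eq_square)
  then show ?thesis
    using s by (subst (asm) mult_left_cancel) auto
qed

lemma Digamma_sums:
  assumes "(0::real) < x"
  shows "(\<lambda>k. 1 / (real k + 1) - 1 / (real k + x)) sums (Digamma x + euler_mascheroni)"
proof -
  have "(\<lambda>k. inverse (of_nat (Suc k)) - inverse (x + of_nat k)) sums (Digamma x + euler_mascheroni)"
    using summable_Digamma[of x] assms by (simp add: Digamma_def summable_sums)
  then show ?thesis
    by (simp add: inverse_eq_divide add_ac)
qed

lemma R_fun_sums:
  assumes "0 < x" "x < 1"
  shows "(\<lambda>k. 1 / (real k + x) + 1 / (real k + 1 - x) - 2 / (real k + 1)) sums R_fun x"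
proof -
  have "(\<lambda>k. - ((1 / (real k + 1) - 1 / (real k + x)) + (1 / (real k + 1) - 1 / (real k + (1 - x))))) sums
      - ((Digamma x + euler_mascheroni) + (Digamma (1 - x) + euler_mascheroni))"
    using assms by (intro sums_minus sums_add Digamma_sums) auto
  moreover have "- ((Digamma x + euler_mascheroni) + (Digamma (1 - x) + euler_mascheroni)) = R_fun x"
    by (simp add: R_fun_def)
  ultimately show ?thesis
    by (simp add: algebra_simps)
qed

lemma cot_half_plus_tan_half:
  fixes y :: real
  assumes "sin (2 * y) \<noteq> 0"
  shows "cot y + tan y = 2 / sin (2 * y)"
proof -
  have "sin y \<noteq> 0" "cos y \<noteq> 0"
    using assms by (auto simp: sin_double)
  then have "cot y + tan y = ((sin y)\<^sup>2 + (cos y)\<^sup>2) / (sin y * cos y)"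
    by (simp add: cot_def tan_def field_simps power2_eq_square)
  also have "\<dots> = 2 / (2 * sin y * cos y)"
    using sin_cos_squared_add[of y] by simp
  finally show ?thesis
    by (simp add: sin_double)
qed

lemma cot_add_pi_half: "cot (y + pi / 2) = - tan y" for y :: real
  by (simp add: cot_def tan_def sin_add cos_add)

text \<open>Pairing the terms 2j and 2j + 1 turns the alternating series into four digamma series
  with arguments x/2, (x+1)/2 and their mirror images 1 - x/2, (1-x)/2. Digamma reflection then
  leaves cot(pi x/2) + tan(pi x/2), up to the factor pi/2.\<close>

lemma B_fun_sums:
  assumes "0 < x" "x < 1"
  shows "(\<lambda>k. (-1) ^ k * (1 / (real k + x) + 1 / (real k + 1 - x))) sums B_fun x"
proof -
  let ?a = "\<lambda>k. 1 / (real k + x) + 1 / (real k + 1 - x)"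
  \<comment> \<open>Pairs determine the sum but not the convergence of the ungrouped series, so the
    existence of a sum is secured first.\<close>
  have "summable (\<lambda>k. (-1) ^ k * ?a k)"
  proof (rule summable_Leibniz'(1))
    have "(\<lambda>k. 1 / (real k + x)) \<longlonglongrightarrow> 0" "(\<lambda>k. 1 / (real k + 1 - x)) \<longlonglongrightarrow> 0"
      by real_asymp+
    then show "?a \<longlonglongrightarrow> 0"
      using tendsto_add by fastforce
    show "0 \<le> ?a n" for n
      using assms by (intro add_nonneg_nonneg divide_nonneg_nonneg) auto
    show "?a (Suc n) \<le> ?a n" for n
      using assms by (intro add_mono divide_left_mono mult_pos_pos) auto
  qed
  then obtain s where s: "(\<lambda>k. (-1) ^ k * ?a k) sums s"
    by (auto simp: summable_def)
  have "(\<lambda>j. \<Sum>k = j * 2..<j * 2 + 2. (-1) ^ k * ?a k) sums s"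
    by (rule sums_group[OF s]) simp
  also have "(\<lambda>j. \<Sum>k = j * 2..<j * 2 + 2. (-1) ^ k * ?a k) = (\<lambda>j. ?a (2 * j) - ?a (2 * j + 1))"
  proof (rule ext)
    fix j :: nat
    have "{j * 2..<j * 2 + 2} = {2 * j, 2 * j + 1}"
      by auto
    then show "(\<Sum>k = j * 2..<j * 2 + 2. (-1) ^ k * ?a k) = ?a (2 * j) - ?a (2 * j + 1)"
      by simp
  qed
  finally have s1: "(\<lambda>j. ?a (2 * j) - ?a (2 * j + 1)) sums s" .
  let ?L = "\<lambda>y k. 1 / (real k + 1) - 1 / (real k + y)"
  have "(\<lambda>j. (1/2) * ((?L ((x+1)/2) j - ?L (x/2) j) + (?L (1 - x/2) j - ?L ((1-x)/2) j))) sums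
     ((1/2) * (((Digamma ((x+1)/2) + euler_mascheroni) - (Digamma (x/2) + euler_mascheroni))
        + ((Digamma (1 - x/2) + euler_mascheroni) - (Digamma ((1-x)/2) + euler_mascheroni))))"
    using assms by (intro sums_mult sums_add sums_diff Digamma_sums) auto
  moreover have "(1/2) * ((?L ((x+1)/2) j - ?L (x/2) j) + (?L (1 - x/2) j - ?L ((1-x)/2) j))
      = ?a (2 * j) - ?a (2 * j + 1)" for j
  proof -
    have h: "1 / (real j + y / 2) = 2 / (2 * real j + y)" if "y > 0" for y
      using that by (simp add: field_simps add_pos_nonneg)
    have "1 / (real j + x/2) = 2 / (2 * real j + x)"
      "1 / (real j + (x+1)/2) = 2 / (2 * real j + (x+1))"
      "1 / (real j + (1-x)/2) = 2 / (2 * real j + (1-x))"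
      "1 / (real j + (2-x)/2) = 2 / (2 * real j + (2-x))"
      using assms by (intro h; simp)+
    moreover have "1 - x/2 = (2-x)/2" by simp
    ultimately show ?thesis
      by (simp only:) (simp add: algebra_simps)
  qed
  ultimately have "s = (1/2) * ((Digamma (1 - x/2) - Digamma (x/2))
      - (Digamma (1 - (x+1)/2) - Digamma ((x+1)/2)))"
    using sums_unique2[OF s1] by (simp add: diff_divide_distrib add_divide_distrib)
  also have "\<dots> = (1/2) * (pi * cot (pi * (x/2)) - pi * cot (pi * ((x+1)/2)))"
    using assms by (subst (1 2) Digamma_reflection_real) auto
  also have "cot (pi * ((x+1)/2)) = - tan (pi * x / 2)"
    using cot_add_pi_half[of "pi * x / 2"] by (simp add: algebra_simps add_divide_distrib)
  also have "(1/2) * (pi * cot (pi * (x/2)) - pi * (- tan (pi * x / 2)))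
      = (pi / 2) * (cot (pi * x / 2) + tan (pi * x / 2))"
    by (simp add: algebra_simps)
  also have "\<dots> = pi / sin (pi * x)"
  proof -
    have "sin (pi * x) > 0"
      using assms by (intro sin_gt_zero) auto
    then show ?thesis
      by (subst cot_half_plus_tan_half) auto
  qed
  finally show ?thesis
    using s by (simp add: B_fun_def Gamma_reflection_real)
qed

definition f_term :: "nat \<Rightarrow> real \<Rightarrow> real" where
  "f_term k x = (1 + x * (1 - x) - (-1) ^ k) * (1 / (real k + x) + 1 / (real k + 1 - x))
     - 2 * (1 + x * (1 - x)) / (real k + 1)"

lemma f_fun_sums:
  assumes "0 < x" "x < 1"
  shows "(\<lambda>k. f_term k x) sums f_fun x"
proof -
  have "(\<lambda>k. (1 + x * (1 - x)) * (1 / (real k + x) + 1 / (real k + 1 - x) - 2 / (real k + 1))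
      - (-1) ^ k * (1 / (real k + x) + 1 / (real k + 1 - x))) sums f_fun x"
    unfolding f_fun_def using assms by (intro sums_diff sums_mult R_fun_sums B_fun_sums)
  moreover have "(1 + x * (1 - x)) * (1 / (real k + x) + 1 / (real k + 1 - x) - 2 / (real k + 1))
      - (-1) ^ k * (1 / (real k + x) + 1 / (real k + 1 - x)) = f_term k x" for k
    unfolding f_term_def left_diff_distrib right_diff_distrib by simp
  ultimately show ?thesis
    by simp
qed

text \<open>For k = 0 and k = 1 the factor in front is x(1 - x) and (1 + x)(2 - x), the product of
  the two denominators, so these terms are polynomials; \<open>1 - 3 * x + 3 * x\<^sup>2\<close> is
  their sum.\<close>

lemma f_fun_sums_shift2:
  assumes "0 < x" "x < 1"
  shows "(\<lambda>k. f_term (k + 2) x) sums (f_fun x - (1 - 3 * x + 3 * x\<^sup>2))"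
proof -
  have "f_term 0 x = 1 - 2 * (1 + x * (1 - x))"
    using assms by (simp add: f_term_def field_simps)
  moreover have "f_term 1 x = 3 - (1 + x * (1 - x))"
  proof -
    have nz: "1 + x \<noteq> 0" "2 - x \<noteq> 0" using assms by auto
    have "(1 + x * (1 - x) + 1) * (1 / (1 + x) + 1 / (2 - x))
        = ((1 + x) * (2 - x)) * (1 / (1 + x) + 1 / (2 - x))"
      by (simp add: algebra_simps)
    also have "\<dots> = 3"
      using nz by (simp add: distrib_left)
    finally have "(1 + x * (1 - x) + 1) * (1 / (1 + x) + 1 / (2 - x)) = 3" .
    moreover have "f_term 1 x = (1 + x * (1 - x) + 1) * (1 / (1 + x) + 1 / (2 - x)) - (1 + x * (1 - x))"
      by (simp add: f_term_def add_divide_distrib)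
    ultimately show ?thesis
      by (simp only:)
  qed
  ultimately have "(\<Sum>k<2. f_term k x) = 1 - 3 * x + 3 * x\<^sup>2"
    by (simp add: numeral_2_eq_2 algebra_simps power2_eq_square)
  then show ?thesis
    using sums_split_initial_segment[OF f_fun_sums[OF assms], of 2] by simp
qed

section \<open>Taylor remainders at 0\<close>

text \<open>
  Apart from a polynomial, \<^term>\<open>f_term k x\<close> equals \<open>- pole_weight k * (1/(k + x) + 1/(k + 1 - x))\<close>;
  \<open>pole_weight\<close> vanishes at 0 and 1. Up to the sign \<open>(-1)^n\<close>, \<open>taylor_term n k\<close> is the Taylor remainder of order
  \<open>n\<close> of this at 0, divided by \<open>x^(n+1)\<close>.
\<close>

definition pole_weight :: "nat \<Rightarrow> real" where
  "pole_weight k = real k * (real k + 1) - 1 + (-1) ^ k"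

definition taylor_term :: "nat \<Rightarrow> nat \<Rightarrow> real \<Rightarrow> real" where
  "taylor_term n k x = pole_weight k * (1 / (real k ^ (n + 1) * (real k + x))
     - (-1) ^ n / ((real k + 1) ^ (n + 1) * (real k + 1 - x)))"

lemma pole_weight_pos: "pole_weight (k + 2) > 0"
proof -
  have "pole_weight (k + 2) = (real k + 2) * (real k + 3) - 1 + (-1) ^ k"
    by (simp add: pole_weight_def add_ac)
  moreover have "(-1::real) ^ k \<ge> -1"
    by (cases "even k") auto
  moreover have "(real k + 2) * (real k + 3) \<ge> 6"
    by (simp add: algebra_simps)
  ultimately show ?thesis
    by linarith
qed

text \<open>One step of the geometric expansion of 1/(a + x), where P collects the powers already
  split off. It serves both poles at 0 (with x and -x) and the expansion in t^2 at the
  midpoint.\<close>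

lemma inverse_remainder:
  fixes P a x :: real
  assumes "P \<noteq> 0" "a \<noteq> 0" "a + x \<noteq> 0"
  shows "1 / (P * (a + x)) = 1 / (P * a) - x * (1 / (P * a * (a + x)))"
  using assms by (simp add: divide_simps)

text \<open>The counterpart of \<open>f_rem_Suc\<close> for a single term: the value at 0 is its
  next Taylor coefficient. The minus sign stems from the factor (-1)^n split off in
  \<open>taylor_term\<close>.\<close>

lemma taylor_term_step:
  assumes "k > 0" "0 \<le> x" "x < 1"
  shows "taylor_term n k x = taylor_term n k 0 - x * taylor_term (Suc n) k x"
proof -
  let ?q = "real k + 1"
  have "1 / (real k ^ (n + 1) * (real k + x)) = 1 / (real k ^ (n + 1) * (real k + 0))
      - x * (1 / (real k ^ (Suc n + 1) * (real k + x)))"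
    using inverse_remainder[of "real k ^ (n + 1)" "real k" x] assms by (simp add: mult_ac)
  moreover have "1 / (?q ^ (n + 1) * (?q - x)) = 1 / (?q ^ (n + 1) * (?q - 0))
      + x * (1 / (?q ^ (Suc n + 1) * (?q - x)))"
    using inverse_remainder[of "?q ^ (n + 1)" "?q" "- x"] assms by (simp add: mult_ac)
  then have "(-1) ^ n * (1 / (?q ^ (n + 1) * (?q - x))) = (-1) ^ n * (1 / (?q ^ (n + 1) * (?q - 0))
      + x * (1 / (?q ^ (Suc n + 1) * (?q - x))))"
    by (rule arg_cong)
  then have "(-1) ^ n / (?q ^ (n + 1) * (?q - x)) = (-1) ^ n / (?q ^ (n + 1) * (?q - 0))
      - x * ((-1) ^ (Suc n) / (?q ^ (Suc n + 1) * (?q - x)))"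
    by (simp add: distrib_left)
  ultimately show ?thesis
    unfolding taylor_term_def by (simp only:) (simp only: algebra_simps)
qed

section \<open>Summation by parts and the values of the Taylor coefficients at 0\<close>

lemma summation_by_parts_sums:
  assumes S: "(\<lambda>k. (pole_weight (k + 2) + \<sigma> * pole_weight (k + 1)) / (real k + 2) ^ m) sums S"
    and L: "(\<lambda>k. pole_weight (k + 1) / (real k + 2) ^ m) \<longlonglongrightarrow> L"
  shows "(\<lambda>k. pole_weight (k + 2) * (1 / (real k + 2) ^ m + \<sigma> / (real k + 3) ^ m)) sums (S + \<sigma> * L)"
proof -
  \<comment> \<open>Shifting the denominator from k + 3 to k + 2 costs a telescoping sum whose first
    term is 0, because \<open>pole_weight 1 = 0\<close>; only the limit L remains.\<close>
  have "(\<lambda>k. pole_weight (Suc k + 1) / (real (Suc k) + 2) ^ m - pole_weight (k + 1) / (real k + 2) ^ m) sums (L - 0)"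
    using telescope_sums[OF L] by (simp add: pole_weight_def)
  from sums_add[OF S sums_mult[OF this, of \<sigma>]] show ?thesis
    by (simp add: algebra_simps add_divide_distrib)
qed

text \<open>Why summation by parts helps: in the sum of neighbouring weights the alternating parts
  cancel, in the difference (next lemma) the squares do. The first case yields zeta values alone,
  the second a zeta and an eta value. The factor 1 matches \<sigma> = 1.\<close>

lemma pole_weight_add: "pole_weight (k + 2) + 1 * pole_weight (k + 1) = 2 * (real k + 2)\<^sup>2 - 2"
  by (simp add: pole_weight_def algebra_simps power2_eq_square)

lemma pole_weight_diff: "pole_weight (k + 2) + (-1) * pole_weight (k + 1) = 2 * (real k + 2) + 2 * (-1) ^ k"
  by (simp add: pole_weight_def algebra_simps)

lemma pole_weight_le: "\<bar>pole_weight (k + 1)\<bar> \<le> (real k + 2)\<^sup>2"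
proof -
  have "\<bar>(-1) ^ (k + 1) :: real\<bar> = 1" by simp
  then have "\<bar>(-1) ^ (k + 1) - 1 :: real\<bar> \<le> 2" by linarith
  moreover have "pole_weight (k + 1) = (real k + 1) * (real k + 2) + ((-1) ^ (k + 1) - 1)"
    by (simp add: pole_weight_def algebra_simps)
  moreover have "(real k + 1) * (real k + 2) + 2 \<le> (real k + 2)\<^sup>2 + 1" "(real k + 1) * (real k + 2) \<ge> 2"
    by (simp_all add: algebra_simps power2_eq_square)
  moreover have "pole_weight (k + 1) \<le> (real k + 1) * (real k + 2)"
    by (cases "even k") (auto simp: pole_weight_def algebra_simps)
  moreover have "(real k + 1) * (real k + 2) \<le> (real k + 2)\<^sup>2"
    by (simp add: algebra_simps power2_eq_square)
  ultimately show ?thesis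
    by linarith
qed

lemma pole_weight_quotient_tendsto_0:
  assumes "m \<ge> 3"
  shows "(\<lambda>k. pole_weight (k + 1) / (real k + 2) ^ m) \<longlonglongrightarrow> 0"
proof (rule Lim_null_comparison)
  show "\<forall>\<^sub>F k in sequentially. norm (pole_weight (k + 1) / (real k + 2) ^ m) \<le> 1 / (real k + 2)"
  proof (intro always_eventually allI)
    fix k
    have "\<bar>pole_weight (k + 1)\<bar> / (real k + 2) ^ m \<le> (real k + 2)\<^sup>2 / (real k + 2) ^ m"
      by (intro divide_right_mono pole_weight_le) auto
    also have "\<dots> \<le> (real k + 2)\<^sup>2 / (real k + 2) ^ 3"
      using assms by (intro divide_left_mono power_increasing) auto
    also have "\<dots> = 1 / (real k + 2)"
      by (simp add: power2_eq_square power3_eq_cube)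
    finally show "norm (pole_weight (k + 1) / (real k + 2) ^ m) \<le> 1 / (real k + 2)"
      by simp
  qed
  show "(\<lambda>k. 1 / (real k + 2)) \<longlonglongrightarrow> 0"
    by real_asymp
qed

text \<open>The borderline exponent: here the boundary term of the summation by parts is 1 instead
  of 0, and it enters the linear coefficient a_1.\<close>

lemma pole_weight_quotient_tendsto_1: "(\<lambda>k. pole_weight (k + 1) / (real k + 2) ^ 2) \<longlonglongrightarrow> 1"
proof -
  have "(\<lambda>k. (-1) ^ (k + 1) / (real k + 2) ^ 2 :: real) \<longlonglongrightarrow> 0"
  proof (rule Lim_null_comparison)
    show "\<forall>\<^sub>F k in sequentially. norm ((-1) ^ (k + 1) / (real k + 2) ^ 2 :: real) \<le> 1 / (real k + 2) ^ 2"
      by (simp add: power_abs)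
  qed real_asymp
  moreover have "(\<lambda>k. ((real k + 1) * (real k + 2) - 1) / (real k + 2) ^ 2) \<longlonglongrightarrow> 1"
    by real_asymp
  ultimately have "(\<lambda>k. ((real k + 1) * (real k + 2) - 1) / (real k + 2) ^ 2
      + (-1) ^ (k + 1) / (real k + 2) ^ 2) \<longlonglongrightarrow> 1 + 0"
    by (intro tendsto_add)
  then show ?thesis
    unfolding add_divide_distrib[symmetric] by (simp add: pole_weight_def algebra_simps)
qed

lemma summable_inverse_powers:
  assumes "n \<ge> 2"
  shows "summable (\<lambda>k. 1 / real (k + 1) ^ n)"
  using inverse_power_summable[OF assms, where ?'a = real]
  by (subst (asm) summable_Suc_iff[symmetric]) (simp add: inverse_eq_divide)

lemma zeta_nat_sums:
  assumes "n \<ge> 2"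
  shows "(\<lambda>k. 1 / (real k + 2) ^ n) sums (zeta_nat n - 1)"
proof -
  have "(\<lambda>k. 1 / real (k + 1) ^ n) sums zeta_nat n"
    unfolding zeta_nat_def by (intro summable_sums summable_inverse_powers assms)
  from sums_split_initial_segment[OF this, of 1] show ?thesis
    by (simp add: add_ac)
qed

text \<open>Dropping the first term shifts the alternating sign, hence 1 - eta rather than eta -
  1.\<close>

lemma eta_nat_sums:
  assumes "n \<ge> 2"
  shows "(\<lambda>k. (-1) ^ k / (real k + 2) ^ n) sums (1 - eta_nat n)"
proof -
  have "summable (\<lambda>k. (-1) ^ k / real (k + 1) ^ n)"
    by (rule summable_norm_cancel) (use summable_inverse_powers[OF assms] in \<open>simp add: power_abs\<close>)
  then have "(\<lambda>k. (-1) ^ k / real (k + 1) ^ n) sums eta_nat n"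
    unfolding eta_nat_def by (rule summable_sums)
  from sums_minus[OF sums_split_initial_segment[OF this, of 1]] show ?thesis
    by (simp add: add_ac)
qed

text \<open>The parity of n decides whether neighbouring weights are subtracted or added, which is
  the origin of the two brackets with (-1)^n in \<open>a_coeff\<close>. For n < 2 the divergent
  zeta(1) would appear.\<close>

lemma taylor_term_0_sums:
  assumes "n \<ge> 2"
  shows "(\<lambda>k. taylor_term n (k + 2) 0) sums ((-1) ^ n * a_coeff (n + 1))"
proof (cases "even n")
  case True
  have p: "2 * (real k + 2) / (real k + 2) ^ (n + 2) = 2 * (1 / (real k + 2) ^ (n + 1))" for k
  proof -
    have "2 * q / q ^ (n + 2) = 2 * (1 / q ^ (n + 1))" for q :: real
      by simp
    then show ?thesis .
  qed
  have "(\<lambda>k. 2 * (1 / (real k + 2) ^ (n + 1)) + 2 * ((-1) ^ k / (real k + 2) ^ (n + 2))) sums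
      (2 * (zeta_nat (n + 1) - 1) + 2 * (1 - eta_nat (n + 2)))"
    using assms by (intro sums_add sums_mult zeta_nat_sums eta_nat_sums) auto
  then have "(\<lambda>k. (pole_weight (k + 2) + (-1) * pole_weight (k + 1)) / (real k + 2) ^ (n + 2)) sums
      (2 * (zeta_nat (n + 1) - 1) + 2 * (1 - eta_nat (n + 2)))"
    unfolding pole_weight_diff add_divide_distrib p by simp
  from summation_by_parts_sums[OF this pole_weight_quotient_tendsto_0]
  have "(\<lambda>k. pole_weight (k + 2) * (1 / (real k + 2) ^ (n + 2) + - 1 / (real k + 3) ^ (n + 2))) sums
      (2 * (zeta_nat (n + 1) - 1) + 2 * (1 - eta_nat (n + 2)) + - 1 * 0)"
    using assms by simp
  moreover have "pole_weight (k + 2) * (1 / (real k + 2) ^ (n + 2) + - 1 / (real k + 3) ^ (n + 2)) = taylor_term n (k + 2) 0" for k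
    using True by (simp add: taylor_term_def mult.commute add_ac)
  moreover have "2 * (zeta_nat (n + 1) - 1) + 2 * (1 - eta_nat (n + 2)) + - 1 * 0 = (-1) ^ n * a_coeff (n + 1)"
    using True assms by (simp add: a_coeff_def)
  ultimately show ?thesis
    by simp
next
  case False
  have p: "2 * (real k + 2)\<^sup>2 / (real k + 2) ^ (n + 2) = 2 * (1 / (real k + 2) ^ n)" for k
  proof -
    have "2 * q\<^sup>2 / q ^ (n + 2) = 2 * (1 / q ^ n)" if "q \<noteq> 0" for q :: real
      using that by (simp add: power2_eq_square)
    from this[of "real k + 2"] show ?thesis by linarith
  qed
  have "(\<lambda>k. 2 * (1 / (real k + 2) ^ n) - 2 * (1 / (real k + 2) ^ (n + 2))) sums
      (2 * (zeta_nat n - 1) - 2 * (zeta_nat (n + 2) - 1))"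
    using assms by (intro sums_diff sums_mult zeta_nat_sums) auto
  then have "(\<lambda>k. (pole_weight (k + 2) + 1 * pole_weight (k + 1)) / (real k + 2) ^ (n + 2)) sums
      (2 * (zeta_nat n - 1) - 2 * (zeta_nat (n + 2) - 1))"
    unfolding pole_weight_add diff_divide_distrib p by simp
  from summation_by_parts_sums[OF this pole_weight_quotient_tendsto_0]
  have "(\<lambda>k. pole_weight (k + 2) * (1 / (real k + 2) ^ (n + 2) + 1 / (real k + 3) ^ (n + 2))) sums
      (2 * (zeta_nat n - 1) - 2 * (zeta_nat (n + 2) - 1) + 1 * 0)"
    using assms by simp
  moreover have "pole_weight (k + 2) * (1 / (real k + 2) ^ (n + 2) + 1 / (real k + 3) ^ (n + 2)) = taylor_term n (k + 2) 0" for k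
    using False by (simp add: taylor_term_def mult.commute add_ac)
  moreover have "2 * (zeta_nat n - 1) - 2 * (zeta_nat (n + 2) - 1) + 1 * 0 = (-1) ^ n * a_coeff (n + 1)"
    using False assms by (auto simp: a_coeff_def)
  ultimately show ?thesis
    by simp
qed

text \<open>Two telescoping series with sum 1/2 each cancel, so a_0 = 1 comes from the polynomial of
  the indices 0 and 1 alone.\<close>

lemma f_term_0_sums: "(\<lambda>k. f_term (k + 2) 0) sums 0"
proof -
  have "(\<lambda>k. 1 / (real k + 2)) \<longlonglongrightarrow> 0"
    by real_asymp
  from telescope_sums'[OF this]
  have 1: "(\<lambda>k. 1 / (real k + 2) - 1 / (real k + 3)) sums (1/2)"
    by (simp add: add_ac)
  have "(\<lambda>k. (-1) ^ k / (real k + 2)) \<longlonglongrightarrow> 0"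
  proof (rule Lim_null_comparison)
    show "\<forall>\<^sub>F k in sequentially. norm ((-1) ^ k / (real k + 2)) \<le> 1 / (real k + 2)"
      by (simp add: power_abs)
  qed real_asymp
  from telescope_sums'[OF this]
  have 2: "(\<lambda>k. (-1) ^ k / (real k + 2) + (-1) ^ k / (real k + 3)) sums (1/2)"
    by (simp add: add_ac)
  have "f_term (k + 2) 0 = (1 / (real k + 2) - 1 / (real k + 3))
     - ((-1) ^ k / (real k + 2) + (-1) ^ k / (real k + 3))" for k
    by (simp add: f_term_def add_ac left_diff_distrib distrib_left diff_divide_distrib)
  with sums_diff[OF 1 2] show ?thesis
    by simp
qed

text \<open>\<open>taylor_term 0 (k + 2) 0\<close> alone behaves like 2/k; the harmonic part of
  \<open>f_term\<close> supplies the compensating 2/(k + 3). The 3 offsets the -3x in the polynomial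
  of the indices 0 and 1.\<close>

lemma linear_coeff_sums:
  "(\<lambda>k. taylor_term 0 (k + 2) 0 - 2 / (real k + 3)) sums (a_coeff 1 + 3)"
proof -
  have "(\<lambda>k. 2 / (real k + 2)) \<longlonglongrightarrow> 0"
    by real_asymp
  from telescope_sums'[OF this]
  have 1: "(\<lambda>k. 2 / (real k + 2) - 2 / (real k + 3)) sums 1"
    by (simp add: add_ac)
  have "(\<lambda>k. pole_weight (Suc k + 1) / (real (Suc k) + 2) ^ 2 - pole_weight (k + 1) / (real k + 2) ^ 2) sums (1 - 0)"
    using telescope_sums[OF pole_weight_quotient_tendsto_1] by (simp add: pole_weight_def)
  from sums_add[OF sums_diff[OF 1 this] sums_mult[OF eta_nat_sums[of 2], of 2]]
  have "(\<lambda>k. 2 / (real k + 2) - 2 / (real k + 3)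
     - (pole_weight (k + 2) / (real k + 3) ^ 2 - pole_weight (k + 1) / (real k + 2) ^ 2)
     + 2 * ((-1) ^ k / (real k + 2) ^ 2)) sums (1 - (1 - 0) + 2 * (1 - eta_nat 2))"
    by (simp add: add_ac)
  moreover have "2 / (real k + 2) - 2 / (real k + 3)
     - (pole_weight (k + 2) / (real k + 3) ^ 2 - pole_weight (k + 1) / (real k + 2) ^ 2)
     + 2 * ((-1) ^ k / (real k + 2) ^ 2) = taylor_term 0 (k + 2) 0 - 2 / (real k + 3)" for k
  proof -
    have "pole_weight (k + 1) = pole_weight (k + 2) - (2 * (real k + 2) + 2 * (-1) ^ k)"
      using pole_weight_diff[of k] by simp
    moreover have "2 * (real k + 2) / (real k + 2) ^ 2 = 2 / (real k + 2)"
    proof -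
      have "2 * q / q ^ 2 = 2 / q" for q :: real
        by (simp add: power2_eq_square)
      then show ?thesis .
    qed
    ultimately have "pole_weight (k + 1) / (real k + 2) ^ 2 = pole_weight (k + 2) / (real k + 2) ^ 2
       - 2 / (real k + 2) - 2 * ((-1) ^ k / (real k + 2) ^ 2)"
      by (simp only: diff_divide_distrib add_divide_distrib)
    then show ?thesis
      by (simp add: taylor_term_def algebra_simps power2_eq_square)
  qed
  ultimately have "(\<lambda>k. taylor_term 0 (k + 2) 0 - 2 / (real k + 3)) sums (1 - (1 - 0) + 2 * (1 - eta_nat 2))"
    by (simp only:)
  then show ?thesis
    by (simp add: a_coeff_def)
qed

text \<open>The same compensation with opposite sign, since x^2 enters 1 + x(1 - x) negatively; the
  3 now offsets the 3x^2 of the polynomial.\<close>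

lemma quadratic_coeff_sums:
  "(\<lambda>k. 2 / (real k + 3) - taylor_term 1 (k + 2) 0) sums (a_coeff 2 - 3)"
proof -
  have "(\<lambda>k. 2 / (real k + 2)) \<longlonglongrightarrow> 0"
    by real_asymp
  from telescope_sums'[OF this]
  have 1: "(\<lambda>k. 2 / (real k + 2) - 2 / (real k + 3)) sums 1"
    by (simp add: add_ac)
  have "(\<lambda>k. pole_weight (Suc k + 1) / (real (Suc k) + 2) ^ 3 - pole_weight (k + 1) / (real k + 2) ^ 3) sums (0 - 0)"
    using telescope_sums[OF pole_weight_quotient_tendsto_0[of 3]] by (simp add: pole_weight_def)
  from sums_diff[OF sums_diff[OF sums_mult[OF zeta_nat_sums[of 3], of 2] this] 1]
  have "(\<lambda>k. 2 * (1 / (real k + 2) ^ 3)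
     - (pole_weight (k + 2) / (real k + 3) ^ 3 - pole_weight (k + 1) / (real k + 2) ^ 3)
     - (2 / (real k + 2) - 2 / (real k + 3))) sums (2 * (zeta_nat 3 - 1) - (0 - 0) - 1)"
    by (simp add: add_ac)
  moreover have "2 * (1 / (real k + 2) ^ 3)
     - (pole_weight (k + 2) / (real k + 3) ^ 3 - pole_weight (k + 1) / (real k + 2) ^ 3)
     - (2 / (real k + 2) - 2 / (real k + 3)) = 2 / (real k + 3) - taylor_term 1 (k + 2) 0" for k
  proof -
    have "pole_weight (k + 1) = 2 * (real k + 2)\<^sup>2 - 2 - pole_weight (k + 2)"
      using pole_weight_add[of k] by simp
    then have "pole_weight (k + 1) / (real k + 2) ^ 3 = 2 / (real k + 2) - 2 * (1 / (real k + 2) ^ 3)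
        - pole_weight (k + 2) / (real k + 2) ^ 3"
      by (simp add: diff_divide_distrib add_divide_distrib power2_eq_square power3_eq_cube)
    then show ?thesis
      by (simp add: taylor_term_def algebra_simps power2_eq_square power3_eq_cube)
  qed
  ultimately have "(\<lambda>k. 2 / (real k + 3) - taylor_term 1 (k + 2) 0) sums (2 * (zeta_nat 3 - 1) - (0 - 0) - 1)"
    by (simp only:)
  then show ?thesis
    by (simp add: a_coeff_def)
qed

text \<open>The expansion stops at order 2 because this is the first order whose remainder is
  summable over k.\<close>

lemma f_term_Taylor:
  assumes "0 \<le> x" "x < 1"
  shows "f_term (k + 2) x = f_term (k + 2) 0 + (taylor_term 0 (k + 2) 0 - 2 / (real k + 3)) * x
     + (2 / (real k + 3) - taylor_term 1 (k + 2) 0) * x\<^sup>2 + x ^ 3 * taylor_term 2 (k + 2) x"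
proof -
  have "f_term (k + 2) y = (2 * real k + 5) - pole_weight (k + 2) * (1 / (real k + 2 + y) + 1 / (real k + 3 - y))
      - 2 / (real k + 3) * (1 + y - y\<^sup>2)" if "0 \<le> y" "y < 1" for y
  proof -
    have nz: "real k + 2 + y \<noteq> 0" "real k + 3 - y \<noteq> 0"
      using that by auto
    \<comment> \<open>Product of the two denominators minus the weight: division leaves the constant
      2k + 5 and the pole part.\<close>
    have "(1 + y * (1 - y) - (-1) ^ k) = (real k + 2 + y) * (real k + 3 - y) - pole_weight (k + 2)"
      by (simp add: pole_weight_def algebra_simps)
    then have "f_term (k + 2) y = ((real k + 2 + y) * (real k + 3 - y) - pole_weight (k + 2))
        * (1 / (real k + 2 + y) + 1 / (real k + 3 - y)) - 2 * (1 + y * (1 - y)) / (real k + 3)"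
      by (simp add: f_term_def add_ac)
    moreover have "(real k + 2 + y) * (real k + 3 - y) * (1 / (real k + 2 + y) + 1 / (real k + 3 - y))
        = 2 * real k + 5"
      using nz by (simp add: distrib_left)
    ultimately show ?thesis
      by (simp only: left_diff_distrib) (simp add: algebra_simps power2_eq_square)
  qed
  note f_term_eq = this
  have p: "taylor_term 0 (k + 2) 0 - x * taylor_term 1 (k + 2) 0 + x\<^sup>2 * taylor_term 2 (k + 2) x = taylor_term 0 (k + 2) x"
  proof -
    have "taylor_term 0 (k + 2) x = taylor_term 0 (k + 2) 0 - x * taylor_term 1 (k + 2) x"
      "x * taylor_term 2 (k + 2) x = taylor_term 1 (k + 2) 0 - taylor_term 1 (k + 2) x"
      using taylor_term_step[of "k + 2" x 0] taylor_term_step[of "k + 2" x 1] assms by (simp_all add: numeral_2_eq_2)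
    then show ?thesis
      by (simp only: power2_eq_square mult.assoc) (simp add: algebra_simps)
  qed
  have "x * taylor_term 0 (k + 2) x = pole_weight (k + 2) * (1 / (real k + 2) + 1 / (real k + 3))
      - pole_weight (k + 2) * (1 / (real k + 2 + x) + 1 / (real k + 3 - x))"
  proof -
    have "x * (1 / ((real k + 2) * (real k + 2 + x))) = 1 / (real k + 2) - 1 / (real k + 2 + x)"
      "x * (1 / ((real k + 3) * (real k + 3 - x))) = 1 / (real k + 3 - x) - 1 / (real k + 3)"
      using assms by (simp_all add: field_simps)
    moreover have "taylor_term 0 (k + 2) x = pole_weight (k + 2) * (1 / ((real k + 2) * (real k + 2 + x))
        - 1 / ((real k + 3) * (real k + 3 - x)))"
      by (simp add: taylor_term_def add_ac)
    ultimately show ?thesis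
      by (simp only: right_diff_distrib mult.left_commute[of x]) (simp only: distrib_left right_diff_distrib)
  qed
  moreover have "f_term (k + 2) x = (2 * real k + 5)
      - pole_weight (k + 2) * (1 / (real k + 2 + x) + 1 / (real k + 3 - x)) - 2 / (real k + 3) * (1 + x - x\<^sup>2)"
    "f_term (k + 2) 0 = (2 * real k + 5)
      - pole_weight (k + 2) * (1 / (real k + 2) + 1 / (real k + 3)) - 2 / (real k + 3)"
    using f_term_eq[of x] f_term_eq[of 0] assms by simp_all
  ultimately have "f_term (k + 2) x - f_term (k + 2) 0
      = x * taylor_term 0 (k + 2) x - 2 / (real k + 3) * (x - x\<^sup>2)"
    by (simp only: algebra_simps)
  also have "\<dots> = (taylor_term 0 (k + 2) 0 - 2 / (real k + 3)) * x
     + (2 / (real k + 3) - taylor_term 1 (k + 2) 0) * x\<^sup>2 + x ^ 3 * taylor_term 2 (k + 2) x"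
    unfolding p[symmetric] power3_eq_cube power2_eq_square by (simp only: algebra_simps)
  finally show ?thesis
    by simp
qed

section \<open>The remainders f_n as series\<close>

lemma f_rem_Suc:
  assumes "x \<noteq> 0"
  shows "f_rem (Suc n) x = (f_rem n x - a_coeff (Suc n)) / x"
  using assms by (simp add: f_rem_def R_poly_def field_simps)

text \<open>The induction starts from the explicit second-order expansion; each further step
  subtracts the values at 0, whose sum is the next coefficient, and divides by x.\<close>

lemma f_rem_sums:
  assumes "0 < x" "x < 1" "n \<ge> 2"
  shows "(\<lambda>k. taylor_term n (k + 2) x) sums ((-1) ^ n * f_rem n x)"
  using assms(3)
proof (induction n rule: dec_induct)
  case base
  let ?S = "f_fun x - (1 - 3 * x + 3 * x\<^sup>2)"
  have "(\<lambda>k. (f_term (k + 2) x - f_term (k + 2) 0 - (taylor_term 0 (k + 2) 0 - 2 / (real k + 3)) * x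
     - (2 / (real k + 3) - taylor_term 1 (k + 2) 0) * x\<^sup>2) / x ^ 3) sums
     ((?S - 0 - (a_coeff 1 + 3) * x - (a_coeff 2 - 3) * x\<^sup>2) / x ^ 3)"
    using assms by (intro sums_divide sums_diff sums_mult2 f_fun_sums_shift2 f_term_0_sums
        linear_coeff_sums quadratic_coeff_sums)
  moreover have "(f_term (k + 2) x - f_term (k + 2) 0 - (taylor_term 0 (k + 2) 0 - 2 / (real k + 3)) * x
     - (2 / (real k + 3) - taylor_term 1 (k + 2) 0) * x\<^sup>2) / x ^ 3 = taylor_term 2 (k + 2) x" for k
    using assms by (subst f_term_Taylor) auto
  moreover have "(?S - 0 - (a_coeff 1 + 3) * x - (a_coeff 2 - 3) * x\<^sup>2) / x ^ 3 = (-1) ^ 2 * f_rem 2 x"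
    by (simp add: f_rem_def R_poly_def numeral_2_eq_2 numeral_3_eq_3)
      (simp add: a_coeff_def algebra_simps)
  ultimately show ?case
    by simp
next
  case (step n)
  have "(\<lambda>k. (taylor_term n (k + 2) 0 - taylor_term n (k + 2) x) / x) sums
     (((-1) ^ n * a_coeff (n + 1) - (-1) ^ n * f_rem n x) / x)"
    using step by (intro sums_divide sums_diff taylor_term_0_sums) auto
  moreover have "(taylor_term n (k + 2) 0 - taylor_term n (k + 2) x) / x = taylor_term (Suc n) (k + 2) x" for k
    using assms by (subst taylor_term_step) auto
  ultimately show ?case
    using assms by (simp add: f_rem_Suc algebra_simps diff_divide_distrib)
qed

text \<open>Makes order 1 accessible: the difference from the value at 0 is -x times a term of the
  next order, which is summable.\<close>

lemma f_rem_diff_sums: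
  assumes "0 < x" "x < 1" "n \<ge> 1"
  shows "(\<lambda>k. taylor_term n (k + 2) x - taylor_term n (k + 2) 0) sums ((-1) ^ n * (f_rem n x - a_coeff (n + 1)))"
proof -
  have "(\<lambda>k. (- x) * taylor_term (Suc n) (k + 2) x) sums ((- x) * ((-1) ^ Suc n * f_rem (Suc n) x))"
    using assms by (intro sums_mult f_rem_sums) auto
  moreover have "(- x) * taylor_term (Suc n) (k + 2) x = taylor_term n (k + 2) x - taylor_term n (k + 2) 0" for k
    using assms by (subst (2) taylor_term_step) auto
  ultimately show ?thesis
    using assms by (simp add: f_rem_Suc)
qed

section \<open>Monotonicity and convexity of f_n\<close>

lemma taylor_term_has_derivative:
  assumes "0 \<le> x" "x < 1"
  shows "(taylor_term n (k + 2) has_real_derivative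
    pole_weight (k + 2) * (- 1 / ((real k + 2) ^ (n + 1) * (real k + 2 + x)\<^sup>2)
      - (-1) ^ n / ((real k + 3) ^ (n + 1) * (real k + 3 - x)\<^sup>2))) (at x)"
proof -
  have nz: "real k + 2 + x \<noteq> 0" "real k + 3 - x \<noteq> 0" "real k + 2 \<noteq> 0" "real k + 3 \<noteq> 0"
    using assms by auto
  have d: "((\<lambda>x. c / (P * (a + \<sigma> * x))) has_real_derivative - c * \<sigma> / (P * (a + \<sigma> * x)\<^sup>2)) (at x)"
    if "P \<noteq> 0" "a + \<sigma> * x \<noteq> 0" for c P a \<sigma> :: real
    using that by (auto intro!: derivative_eq_intros simp: divide_simps power2_eq_square)
  have "((\<lambda>x. pole_weight (k + 2) * (1 / ((real k + 2) ^ (n + 1) * (real k + 2 + 1 * x))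
     - (-1) ^ n / ((real k + 3) ^ (n + 1) * (real k + 3 + (- 1) * x)))) has_real_derivative
    pole_weight (k + 2) * (- 1 * 1 / ((real k + 2) ^ (n + 1) * (real k + 2 + 1 * x)\<^sup>2)
      - - ((-1) ^ n) * (-1) / ((real k + 3) ^ (n + 1) * (real k + 3 + (- 1) * x)\<^sup>2))) (at x)"
    using nz by (intro DERIV_cmult DERIV_diff d) auto
  moreover have "taylor_term n (k + 2) = (\<lambda>x. pole_weight (k + 2) * (1 / ((real k + 2) ^ (n + 1) * (real k + 2 + 1 * x))
     - (-1) ^ n / ((real k + 3) ^ (n + 1) * (real k + 3 + (- 1) * x))))"
    by (rule ext) (simp add: taylor_term_def add_ac)
  ultimately show ?thesis
    by simp
qed

lemma taylor_term_has_second_derivative: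
  assumes "0 \<le> x" "x < 1"
  shows "((\<lambda>x. pole_weight (k + 2) * (- 1 / ((real k + 2) ^ (n + 1) * (real k + 2 + x)\<^sup>2)
      - (-1) ^ n / ((real k + 3) ^ (n + 1) * (real k + 3 - x)\<^sup>2))) has_real_derivative
    2 * pole_weight (k + 2) * (1 / ((real k + 2) ^ (n + 1) * (real k + 2 + x) ^ 3)
      - (-1) ^ n / ((real k + 3) ^ (n + 1) * (real k + 3 - x) ^ 3))) (at x)"
proof -
  have nz: "real k + 2 + x \<noteq> 0" "real k + 3 - x \<noteq> 0" "real k + 2 \<noteq> 0" "real k + 3 \<noteq> 0"
    using assms by auto
  have d: "((\<lambda>x. c / (P * (a + \<sigma> * x)\<^sup>2)) has_real_derivative - 2 * c * \<sigma> / (P * (a + \<sigma> * x) ^ 3)) (at x)"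
    if "P \<noteq> 0" "a + \<sigma> * x \<noteq> 0" for c P a \<sigma> :: real
    using that
    by (auto intro!: derivative_eq_intros simp: divide_simps power2_eq_square power3_eq_cube)
  have "((\<lambda>x. pole_weight (k + 2) * (- 1 / ((real k + 2) ^ (n + 1) * (real k + 2 + 1 * x)\<^sup>2)
      - (-1) ^ n / ((real k + 3) ^ (n + 1) * (real k + 3 + (- 1) * x)\<^sup>2))) has_real_derivative
    pole_weight (k + 2) * (- 2 * (- 1) * 1 / ((real k + 2) ^ (n + 1) * (real k + 2 + 1 * x) ^ 3)
      - - 2 * ((-1) ^ n) * (- 1) / ((real k + 3) ^ (n + 1) * (real k + 3 + (- 1) * x) ^ 3))) (at x)"
    using nz by (intro DERIV_cmult DERIV_diff d) auto
  then show ?thesis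
    by (simp add: algebra_simps)
qed

text \<open>The place where x <= 1/2 enters: it gives k + 2 + x <= k + 3 - x, and strictness comes
  from k + 2 < k + 3. The absolute value covers both parities of n; m = 2 serves the first
  derivative, m = 3 the second.\<close>

lemma reflected_pole_dominated:
  assumes "0 \<le> x" "x \<le> 1/2"
  shows "\<bar>(-1) ^ n / ((real k + 3) ^ (n + 1) * (real k + 3 - x) ^ m)\<bar>
    < 1 / ((real k + 2) ^ (n + 1) * (real k + 2 + x) ^ m)"
proof -
  have "(real k + 2) ^ (n + 1) * (real k + 2 + x) ^ m < (real k + 3) ^ (n + 1) * (real k + 3 - x) ^ m"
    using assms by (intro mult_less_le_imp_less power_strict_mono power_mono) auto
  moreover have "(real k + 2) ^ (n + 1) * (real k + 2 + x) ^ m > 0"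
    using assms by simp
  ultimately have "1 / ((real k + 3) ^ (n + 1) * (real k + 3 - x) ^ m)
      < 1 / ((real k + 2) ^ (n + 1) * (real k + 2 + x) ^ m)"
    by (intro divide_strict_left_mono) auto
  moreover have "real k + 3 - x > 0"
    using assms by simp
  ultimately show ?thesis
    by (simp add: abs_mult power_abs del: power_Suc)
qed

lemma taylor_term_strict_decreasing:
  assumes "0 \<le> x" "x < y" "y \<le> 1/2"
  shows "taylor_term n (k + 2) y < taylor_term n (k + 2) x"
proof (rule DERIV_neg_imp_decreasing[OF assms(2)])
  fix z assume z: "x \<le> z" "z \<le> y"
  have "- 1 / ((real k + 2) ^ (n + 1) * (real k + 2 + z)\<^sup>2)
      - (-1) ^ n / ((real k + 3) ^ (n + 1) * (real k + 3 - z)\<^sup>2) < 0"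
    using reflected_pole_dominated[of z n k 2] z assms unfolding minus_divide_left[symmetric] by linarith
  then have "pole_weight (k + 2) * (- 1 / ((real k + 2) ^ (n + 1) * (real k + 2 + z)\<^sup>2)
      - (-1) ^ n / ((real k + 3) ^ (n + 1) * (real k + 3 - z)\<^sup>2)) < 0"
    using pole_weight_pos by (rule mult_pos_neg[rotated])
  then show "\<exists>d. (taylor_term n (k + 2) has_real_derivative d) (at z) \<and> d < 0"
    using taylor_term_has_derivative[of z n k] z assms by force
qed

lemma taylor_term_convex: "convex_on {0<..1/2} (taylor_term n (k + 2))"
proof (rule f''_ge0_imp_convex[OF _ taylor_term_has_derivative taylor_term_has_second_derivative])
  fix z :: real assume z: "z \<in> {0<..1/2}"
  have "0 \<le> 1 / ((real k + 2) ^ (n + 1) * (real k + 2 + z) ^ 3)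
      - (-1) ^ n / ((real k + 3) ^ (n + 1) * (real k + 3 - z) ^ 3)"
    using reflected_pole_dominated[of z n k 3] z unfolding greaterThanAtMost_iff by linarith
  then show "0 \<le> 2 * pole_weight (k + 2) * (1 / ((real k + 2) ^ (n + 1) * (real k + 2 + z) ^ 3)
      - (-1) ^ n / ((real k + 3) ^ (n + 1) * (real k + 3 - z) ^ 3))"
    using pole_weight_pos[of k] by (intro mult_nonneg_nonneg) auto
qed auto

lemma sums_pos:
  fixes g :: "nat \<Rightarrow> real"
  assumes "g sums s" "\<And>k. 0 < g k"
  shows "0 < s"
  using suminf_pos[of g] assms by (auto simp: sums_iff)

lemma convex_on_sums:
  fixes g :: "nat \<Rightarrow> 'a::real_vector \<Rightarrow> real"
  assumes "\<And>k. convex_on S (g k)" and G: "\<And>x. x \<in> S \<Longrightarrow> (\<lambda>k. g k x) sums G x"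
  shows "convex_on S G"
proof -
  have S: "convex S"
    using assms(1) by (rule convex_on_imp_convex)
  show ?thesis
    unfolding convex_on_def
  proof (intro conjI ballI allI impI S)
    fix x y and u v :: real
    assume *: "x \<in> S" "y \<in> S" "0 \<le> u" "0 \<le> v" "u + v = 1"
    show "G (u *\<^sub>R x + v *\<^sub>R y) \<le> u * G x + v * G y"
    proof (rule sums_le)
      show "(\<lambda>k. g k (u *\<^sub>R x + v *\<^sub>R y)) sums G (u *\<^sub>R x + v *\<^sub>R y)"
        using * S by (intro G) (simp add: convex_def)
      show "(\<lambda>k. u * g k x + v * g k y) sums (u * G x + v * G y)"
        using * by (intro sums_add sums_mult G)
      show "g k (u *\<^sub>R x + v *\<^sub>R y) \<le> u * g k x + v * g k y" for k
        using assms(1)[of k] * by (simp add: convex_on_def)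
    qed
  qed
qed

lemma convex_on_affine:
  assumes "convex S"
  shows "convex_on S (\<lambda>x::real. c + d * x)"
  unfolding convex_on_def
proof (intro conjI ballI allI impI assms)
  fix x y u v :: real assume "u + v = 1"
  then have "c = u * c + v * c"
    by (metis distrib_right mult_1)
  then show "c + d * (u *\<^sub>R x + v *\<^sub>R y) \<le> u * (c + d * x) + v * (c + d * y)"
    by (simp add: algebra_simps)
qed

text \<open>The values at 0 are subtracted from both series to make them converge for n = 1; they
  cancel in the difference.\<close>

lemma f_rem_strict_mono:
  assumes "n \<ge> 1" "0 < x" "x < y" "y \<le> 1/2"
  shows "(-1) ^ n * f_rem n y < (-1) ^ n * f_rem n x"
proof -
  have "(\<lambda>k. (taylor_term n (k + 2) x - taylor_term n (k + 2) 0) - (taylor_term n (k + 2) y - taylor_term n (k + 2) 0)) sums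
     ((-1) ^ n * (f_rem n x - a_coeff (n + 1)) - (-1) ^ n * (f_rem n y - a_coeff (n + 1)))"
    using assms by (intro sums_diff f_rem_diff_sums) auto
  then have "0 < (-1) ^ n * (f_rem n x - a_coeff (n + 1)) - (-1) ^ n * (f_rem n y - a_coeff (n + 1))"
    by (rule sums_pos) (use taylor_term_strict_decreasing[of x y n] assms in simp)
  then show ?thesis
    by (simp add: algebra_simps)
qed

lemma f_rem_less_coeff:
  assumes "n \<ge> 1" "0 < x" "x \<le> 1/2"
  shows "(-1) ^ n * f_rem n x < (-1) ^ n * a_coeff (n + 1)"
proof -
  have "(\<lambda>k. - (taylor_term n (k + 2) x - taylor_term n (k + 2) 0)) sums (- ((-1) ^ n * (f_rem n x - a_coeff (n + 1))))"
    using assms by (intro sums_minus f_rem_diff_sums) auto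
  then have "0 < - ((-1) ^ n * (f_rem n x - a_coeff (n + 1)))"
    by (rule sums_pos) (use taylor_term_strict_decreasing[of 0 x n] assms in simp)
  then show ?thesis
    by (simp add: algebra_simps)
qed

lemma f_rem_convex:
  assumes "n \<ge> 1"
  shows "convex_on {0<..1/2} (\<lambda>x. (-1) ^ n * f_rem n x)"
proof -
  have "convex_on {0<..1/2} (\<lambda>x. (-1) ^ n * (f_rem n x - a_coeff (n + 1)))"
  proof (rule convex_on_sums)
    show "convex_on {0<..1/2} (\<lambda>x. taylor_term n (k + 2) x - taylor_term n (k + 2) 0)" for k
      using convex_on_add[OF taylor_term_convex convex_on_affine[of "{0<..1/2}" "- taylor_term n (k + 2) 0" 0]] by simp
    show "(\<lambda>k. taylor_term n (k + 2) x - taylor_term n (k + 2) 0) sums ((-1) ^ n * (f_rem n x - a_coeff (n + 1)))"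
      if "x \<in> {0<..1/2}" for x
      using that assms by (intro f_rem_diff_sums) auto
  qed
  from convex_on_add[OF this convex_on_affine[of "{0<..1/2}" "(-1) ^ n * a_coeff (n + 1)" 0]]
  show ?thesis
    by (simp add: algebra_simps)
qed

text \<open>\<open>taylor_term 0\<close> differs from x^2 times \<open>taylor_term 2\<close> by an
  affine function, so the summable terms of order 2, multiplied by x^2, are still convex. The sum is
  f_0 minus an affine function.\<close>

lemma f_rem_0_convex: "convex_on {0<..1/2} (f_rem 0)"
proof -
  have "convex_on {0<..1/2} (\<lambda>x. f_rem 0 x - (a_coeff 1 + a_coeff 2 * x))"
  proof (rule convex_on_sums)
    show "convex_on {0<..1/2} (\<lambda>x. taylor_term 0 (k + 2) x + (- taylor_term 0 (k + 2) 0 + taylor_term 1 (k + 2) 0 * x))" for k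
      by (intro convex_on_add taylor_term_convex convex_on_affine) simp
    fix x :: real assume x: "x \<in> {0<..1/2}"
    have "(\<lambda>k. x\<^sup>2 * taylor_term 2 (k + 2) x) sums (x\<^sup>2 * ((-1) ^ 2 * f_rem 2 x))"
      using x by (intro sums_mult f_rem_sums) auto
    moreover have "x\<^sup>2 * taylor_term 2 (k + 2) x = taylor_term 0 (k + 2) x + (- taylor_term 0 (k + 2) 0 + taylor_term 1 (k + 2) 0 * x)" for k
    proof -
      have "taylor_term 0 (k + 2) x = taylor_term 0 (k + 2) 0 - x * taylor_term 1 (k + 2) x"
        "x * taylor_term 2 (k + 2) x = taylor_term 1 (k + 2) 0 - taylor_term 1 (k + 2) x"
        using taylor_term_step[of "k + 2" x 0] taylor_term_step[of "k + 2" x 1] x by (simp_all add: numeral_2_eq_2)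
      then show ?thesis
        by (simp only: power2_eq_square mult.assoc) (simp add: algebra_simps)
    qed
    moreover have "x\<^sup>2 * ((-1) ^ 2 * f_rem 2 x) = f_rem 0 x - (a_coeff 1 + a_coeff 2 * x)"
      using x by (simp add: numeral_2_eq_2 f_rem_Suc field_simps)
    ultimately show "(\<lambda>k. taylor_term 0 (k + 2) x + (- taylor_term 0 (k + 2) 0 + taylor_term 1 (k + 2) 0 * x))
        sums (f_rem 0 x - (a_coeff 1 + a_coeff 2 * x))"
      by (simp only:)
  qed
  from convex_on_add[OF this convex_on_affine[of "{0<..1/2}" "a_coeff 1" "a_coeff 2"]]
  show ?thesis
    by simp
qed

lemma a_coeff_2_pos: "a_coeff 2 > 0"
proof -
  have "0 < (\<Sum>k. 1 / real (k + 1) ^ 3)"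
    by (intro suminf_pos summable_inverse_powers) auto
  then show ?thesis
    by (simp add: a_coeff_def zeta_nat_def)
qed

lemma f_rem_0_eq: "x \<noteq> 0 \<Longrightarrow> f_rem 0 x = a_coeff 1 + x * f_rem 1 x"
  by (simp add: f_rem_Suc)

lemma f_rem_1_pos: "0 < x \<Longrightarrow> x \<le> 1/2 \<Longrightarrow> 0 < f_rem 1 x"
  using f_rem_less_coeff[of 1 x] a_coeff_2_pos by (simp add: numeral_2_eq_2)

text \<open>The single terms of order 0 decrease, so termwise comparison is of no use. Instead f_0 =
  a_1 + x f_1, where f_1 increases and exceeds a_2 = 2 zeta(3) > 0.\<close>

lemma f_rem_0_strict_mono:
  assumes "0 < x" "x < y" "y \<le> 1/2"
  shows "f_rem 0 x < f_rem 0 y"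
proof -
  have "x * f_rem 1 x < y * f_rem 1 y"
    using assms f_rem_strict_mono[of 1 x y] f_rem_1_pos[of x] by (intro mult_strict_mono) auto
  then show ?thesis
    using assms by (simp add: f_rem_0_eq)
qed

section \<open>Limits at 0 and ranges of f_n\<close>

lemma f_rem_bounded:
  assumes "n \<ge> 1" "0 < x" "x \<le> 1/2"
  shows "\<bar>f_rem n x\<bar> \<le> \<bar>a_coeff (n + 1)\<bar> + \<bar>f_rem n (1/2)\<bar>"
proof -
  have "(-1) ^ n * f_rem n (1/2) \<le> (-1) ^ n * f_rem n x"
  proof (cases "x = 1/2")
    case True
    show ?thesis
      unfolding True ..
  next
    case False
    then show ?thesis
      using f_rem_strict_mono[of n x "1/2"] assms by simp
  qed
  with f_rem_less_coeff[OF assms] show ?thesis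
    by (cases "even n") auto
qed

text \<open>f_n - a_{n+1} = x f_{n+1}, and f_{n+1} is bounded, lying between its coefficient at 0
  and its value at 1/2. Since n + 1 >= 1, order 0 is included.\<close>

lemma f_rem_tendsto: "(f_rem n \<longlongrightarrow> a_coeff (n + 1)) (at_right 0)"
proof (rule LIM_zero_cancel, rule Lim_null_comparison)
  let ?M = "\<bar>a_coeff (n + 2)\<bar> + \<bar>f_rem (n + 1) (1/2)\<bar>"
  show "\<forall>\<^sub>F x in at_right 0. norm (f_rem n x - a_coeff (n + 1)) \<le> x * ?M"
    using eventually_at_right_real[of 0 "1/2::real", OF half_gt_zero[OF zero_less_one]]
  proof eventually_elim
    case (elim x)
    then have "\<bar>f_rem (n + 1) x\<bar> \<le> ?M"
      using f_rem_bounded[of "n + 1" x] by simp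
    then have "x * \<bar>f_rem (n + 1) x\<bar> \<le> x * ?M"
      using elim by (intro mult_left_mono) auto
    then show ?case
      using elim by (simp add: f_rem_Suc)
  qed
  have "((\<lambda>x::real. x * ?M) \<longlongrightarrow> 0 * ?M) (at_right 0)"
    by (intro tendsto_intros)
  then show "((\<lambda>x::real. x * ?M) \<longlongrightarrow> 0) (at_right 0)"
    by simp
qed

lemma f_fun_continuous: "continuous_on {0<..<1} f_fun"
proof -
  have 1: "y \<notin> \<int>\<^sub>\<le>\<^sub>0" if "y > 0" for y :: real
    using that nonpos_Ints_nonpos by fastforce
  have D: "continuous_on {0<..} (Digamma :: real \<Rightarrow> real)"
    by (intro continuous_on_Polygamma) (use 1 in auto)
  have G: "continuous_on {0<..} (Gamma :: real \<Rightarrow> real)"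
    by (intro continuous_on_Gamma) (use 1 in auto)
  have r: "continuous_on {0<..<1} (\<lambda>x. 1 - x :: real)"
    by (intro continuous_on_diff continuous_on_const continuous_on_id)
  have "continuous_on {0<..<1} (\<lambda>x. Digamma (1 - x :: real))" "continuous_on {0<..<1} (\<lambda>x. Gamma (1 - x :: real))"
    by (rule continuous_on_compose2[OF D r] continuous_on_compose2[OF G r]; force)+
  moreover have "continuous_on {0<..<1} (Digamma :: real \<Rightarrow> real)" "continuous_on {0<..<1} (Gamma :: real \<Rightarrow> real)"
    by (rule continuous_on_subset[OF D] continuous_on_subset[OF G]; force)+
  ultimately show ?thesis
    unfolding f_fun_def[abs_def] R_fun_def B_fun_def
    by (intro continuous_on_diff continuous_on_mult continuous_on_add continuous_on_const continuous_on_id)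
qed

lemma f_rem_continuous: "continuous_on {0<..1/2} (f_rem n)"
  unfolding f_rem_def[abs_def] R_poly_def
  by (intro continuous_intros continuous_on_subset[OF f_fun_continuous]) auto

lemma image_strict_mono_on:
  fixes F :: "real \<Rightarrow> real"
  assumes mono: "strict_mono_on {0<..b} F" and cont: "continuous_on {0<..b} F"
    and lim: "(F \<longlongrightarrow> a) (at_right 0)" and b: "b > 0"
  shows "F ` {0<..b} = {a<..F b}"
proof (intro equalityI subsetI)
  fix y assume "y \<in> F ` {0<..b}"
  then obtain x where x: "0 < x" "x \<le> b" "y = F x"
    by auto
  \<comment> \<open>Passing to the limit loses strictness; the detour through x/2 restores
    it.\<close>
  have "\<forall>\<^sub>F z in at_right 0. z \<in> {0<..<x / 2}"
    using x by (intro eventually_at_right_real) simp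
  then have "\<forall>\<^sub>F z in at_right 0. F z \<le> F (x / 2)"
  proof (rule eventually_mono)
    fix z assume "z \<in> {0<..<x / 2}"
    then show "F z \<le> F (x / 2)"
      using x by (intro less_imp_le strict_mono_onD[OF mono]) auto
  qed
  then have "a \<le> F (x / 2)"
    using tendsto_upperbound[OF lim] by simp
  also have "F (x / 2) < F x"
    using x by (intro strict_mono_onD[OF mono]) auto
  finally have "a < y"
    using x by simp
  moreover have "F x \<le> F b"
    using x b strict_mono_onD[OF mono, of x b] by (cases "x = b") auto
  ultimately show "y \<in> {a<..F b}"
    using x by simp
next
  fix y assume y: "y \<in> {a<..F b}"
  have "\<forall>\<^sub>F z in at_right 0. F z < y \<and> z \<in> {0<..<b}"
    using order_tendstoD(2)[OF lim, of y] eventually_at_right_real[OF b] y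
    by (auto intro: eventually_conj)
  then obtain z where z: "F z < y" "0 < z" "z < b"
    using eventually_happens'[OF trivial_limit_at_right_real] by fastforce
  have "\<exists>x\<ge>z. x \<le> b \<and> F x = y"
    using y z by (intro IVT' continuous_on_subset[OF cont]) auto
  then show "y \<in> F ` {0<..b}"
    using z by auto
qed

lemma f_fun_half: "f_fun (1/2) = b_coeff 0"
proof -
  have "R_fun (1/2) = 4 * ln 2"
    by (simp add: R_fun_def Digamma_one_half)
  moreover have "B_fun (1/2) = pi"
    using Gamma_reflection_real[of "1/2"] by (simp add: B_fun_def)
  ultimately show ?thesis
    by (simp add: f_fun_def b_coeff_def)
qed

lemma f_rem_half: "f_rem n (1/2) = A_const n"
  by (simp add: f_rem_def A_const_def f_fun_half R_poly_def power_one_over field_simps)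

lemma f_rem_odd_strict_mono:
  "odd n \<Longrightarrow> strict_mono_on {0<..1/2} (f_rem n)"
  using f_rem_strict_mono[of n] by (intro strict_mono_onI) (auto simp: odd_pos Suc_le_eq)

lemma f_rem_even_strict_antimono:
  "even n \<Longrightarrow> n > 0 \<Longrightarrow> strict_antimono_on {0<..1/2} (f_rem n)"
  using f_rem_strict_mono[of n] by (intro monotone_onI) (auto simp: Suc_le_eq)

lemma f_rem_odd_concave: "odd n \<Longrightarrow> concave_on {0<..1/2} (f_rem n)"
  using f_rem_convex[of n] by (simp add: concave_on_def odd_pos Suc_le_eq)

lemma f_rem_even_convex: "even n \<Longrightarrow> convex_on {0<..1/2} (f_rem n)"
  using f_rem_convex[of n] f_rem_0_convex by (cases "n = 0") (auto simp: Suc_le_eq)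

lemma f_rem_0_image: "f_rem 0 ` {0<..1/2} = {a_coeff 1<..2 * (b_coeff 0 - 1)}"
proof -
  have "f_rem 0 ` {0<..1/2} = {a_coeff (0 + 1)<..f_rem 0 (1/2)}"
    by (intro image_strict_mono_on strict_mono_onI f_rem_0_strict_mono f_rem_continuous f_rem_tendsto) auto
  then show ?thesis
    by (simp add: f_rem_half A_const_def a_coeff_def)
qed

lemma f_rem_odd_image: "odd n \<Longrightarrow> f_rem n ` {0<..1/2} = {a_coeff (n + 1)<..A_const n}"
  unfolding f_rem_half[symmetric]
  by (intro image_strict_mono_on f_rem_odd_strict_mono f_rem_continuous f_rem_tendsto) auto

lemma f_rem_even_image:
  assumes "even n" "n > 0"
  shows "f_rem n ` {0<..1/2} = {A_const n..<a_coeff (n + 1)}"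
proof -
  have "(\<lambda>x. - f_rem n x) ` {0<..1/2} = {- a_coeff (n + 1)<..- f_rem n (1/2)}"
    using f_rem_even_strict_antimono[OF assms]
    by (intro image_strict_mono_on continuous_on_minus f_rem_continuous tendsto_minus f_rem_tendsto)
      (auto simp: monotone_on_def)
  then have "uminus ` (\<lambda>x. - f_rem n x) ` {0<..1/2} = uminus ` {- a_coeff (n + 1)<..- A_const n}"
    by (simp add: f_rem_half)
  then show ?thesis
    by (simp add: image_image)
qed

section \<open>Bounds for R from the expansion at 0\<close>

lemma f_fun_eq_f_rem: "x \<noteq> 0 \<Longrightarrow> f_fun x = R_poly n x + f_rem n x * x ^ (n + 1)"
  by (simp add: f_rem_def)

lemma R_fun_eq:
  assumes "0 < x" "x \<le> 1/2"
  shows "R_fun x = (B_fun x + f_fun x) / (1 + x * (1 - x))"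
proof -
  have "1 + x * (1 - x) > 0"
    using assms by (intro add_pos_nonneg) auto
  then show ?thesis
    by (simp add: f_fun_def)
qed

lemma R_fun_bounds:
  assumes x: "0 < x" "x \<le> 1/2"
    and L: "L \<le> f_fun x" "L = f_fun x \<longleftrightarrow> x = 1/2"
    and U: "f_fun x \<le> U" "f_fun x = U \<longleftrightarrow> x = 1/2"
  shows "(B_fun x + L) / (1 + x * (1 - x)) \<le> R_fun x \<and> R_fun x \<le> (B_fun x + U) / (1 + x * (1 - x))
    \<and> ((B_fun x + L) / (1 + x * (1 - x)) = R_fun x \<longleftrightarrow> x = 1/2)
    \<and> (R_fun x = (B_fun x + U) / (1 + x * (1 - x)) \<longleftrightarrow> x = 1/2)"
proof -
  have "1 + x * (1 - x) > 0"
    using x by (intro add_pos_nonneg) auto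
  then show ?thesis
    using L U unfolding R_fun_eq[OF x] by (auto simp: divide_le_cancel)
qed

lemma f_rem_sign:
  assumes "n \<ge> 1" "0 < x" "x \<le> 1/2"
  shows "(-1) ^ n * A_const n \<le> (-1) ^ n * f_rem n x" "f_rem n x = A_const n \<longleftrightarrow> x = 1/2"
proof -
  have "(-1) ^ n * A_const n < (-1) ^ n * f_rem n x" if "x \<noteq> 1/2"
    using f_rem_strict_mono[of n x "1/2"] assms that by (simp add: f_rem_half)
  then show "(-1) ^ n * A_const n \<le> (-1) ^ n * f_rem n x" "f_rem n x = A_const n \<longleftrightarrow> x = 1/2"
    using f_rem_half[of n] by (cases "x = 1/2"; force)+
qed

text \<open>On (0,1/2] the remainder of even order attains its minimum at 1/2 and that of odd order
  its maximum, so even orders bound from below and odd ones from above. Both values at 1/2 are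
  \<open>A_const\<close>.\<close>

lemma R_fun_bounds_Taylor:
  assumes x: "0 < x" "x \<le> 1/2" and n: "even n" "odd m" "n > 0"
  shows "(let L = (B_fun x + R_poly n x + A_const n * x ^ (n + 1)) / (1 + x * (1 - x));
              U = (B_fun x + R_poly m x + A_const m * x ^ (m + 1)) / (1 + x * (1 - x))
          in L \<le> R_fun x \<and> R_fun x \<le> U \<and> (L = R_fun x \<longleftrightarrow> x = 1/2) \<and> (R_fun x = U \<longleftrightarrow> x = 1/2))"
  unfolding Let_def add.assoc[of "B_fun x"]
proof (rule R_fun_bounds[OF x])
  have [simp]: "x \<noteq> 0" "x ^ Suc k > 0" for k
    using x by auto
  note f = f_fun_eq_f_rem[OF \<open>x \<noteq> 0\<close>, of n] f_fun_eq_f_rem[OF \<open>x \<noteq> 0\<close>, of m]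
  have m: "m \<ge> 1" and n1: "n \<ge> 1"
    using n by (auto simp: odd_pos Suc_le_eq)
  show "R_poly n x + A_const n * x ^ (n + 1) \<le> f_fun x"
    "R_poly n x + A_const n * x ^ (n + 1) = f_fun x \<longleftrightarrow> x = 1/2"
    unfolding f(1) using f_rem_sign[OF n1 x] n by (auto simp del: power_Suc)
  show "f_fun x \<le> R_poly m x + A_const m * x ^ (m + 1)"
    "f_fun x = R_poly m x + A_const m * x ^ (m + 1) \<longleftrightarrow> x = 1/2"
    unfolding f(2) using f_rem_sign[OF m x] n by (auto simp del: power_Suc)
qed

section \<open>Expansion at the midpoint\<close>

text \<open>
  With \<open>t = 1 - 2x\<close> and \<open>u = 2k + 1\<close>, the polar part \<open>- pole_weight k * (1/(k + x) + 1/(k + 1 - x))\<close> is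
  \<open>- 4 pole_weight k * u / (u^2 - t^2)\<close>; \<open>midpoint_term n k t\<close> is its remainder after the term \<open>t^(2n)\<close>, divided by
  \<open>t^(2n+2)\<close>.
\<close>

definition midpoint_term :: "nat \<Rightarrow> nat \<Rightarrow> real \<Rightarrow> real" where
  "midpoint_term n k t = - 4 * pole_weight k / ((2 * real k + 1) ^ (2 * n + 1) * ((2 * real k + 1)\<^sup>2 - t\<^sup>2))"

lemma square_diff_pos:
  fixes t u :: real
  assumes "\<bar>t\<bar> < u"
  shows "0 < u\<^sup>2 - t\<^sup>2"
  using assms power_strict_mono[of "\<bar>t\<bar>" u 2] by simp

lemma midpoint_term_neg:
  assumes "\<bar>t\<bar> \<le> 1"
  shows "midpoint_term n (k + 2) t < 0"
proof -
  have "0 < (2 * real (k + 2) + 1)\<^sup>2 - t\<^sup>2"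
    using assms by (intro square_diff_pos) auto
  then have "0 < pole_weight (k + 2) / ((2 * real (k + 2) + 1) ^ (2 * n + 1) * ((2 * real (k + 2) + 1)\<^sup>2 - t\<^sup>2))"
    by (intro divide_pos_pos mult_pos_pos pole_weight_pos) auto
  then show ?thesis
    unfolding midpoint_term_def by (simp del: power_Suc)
qed

lemma midpoint_term_step:
  assumes "\<bar>t\<bar> \<le> 1"
  shows "midpoint_term n (k + 2) t = midpoint_term n (k + 2) 0 + t\<^sup>2 * midpoint_term (Suc n) (k + 2) t"
proof -
  define u where "u = 2 * real (k + 2) + 1"
  have u: "u > 0" "u\<^sup>2 - t\<^sup>2 > 0"
    using assms square_diff_pos[of t u] unfolding u_def by auto
  have "u ^ (2 * n + 1) * u\<^sup>2 = u ^ (2 * Suc n + 1)"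
    by (simp only: power_add[symmetric]) simp
  then have "1 / (u ^ (2 * n + 1) * (u\<^sup>2 - t\<^sup>2)) = 1 / (u ^ (2 * n + 1) * (u\<^sup>2 - 0\<^sup>2))
      + t\<^sup>2 * (1 / (u ^ (2 * Suc n + 1) * (u\<^sup>2 - t\<^sup>2)))"
    using inverse_remainder[of "u ^ (2 * n + 1)" "u\<^sup>2" "- t\<^sup>2"] u by simp
  then have "- 4 * pole_weight (k + 2) * (1 / (u ^ (2 * n + 1) * (u\<^sup>2 - t\<^sup>2)))
      = - 4 * pole_weight (k + 2) * (1 / (u ^ (2 * n + 1) * (u\<^sup>2 - 0\<^sup>2))
      + t\<^sup>2 * (1 / (u ^ (2 * Suc n + 1) * (u\<^sup>2 - t\<^sup>2))))"
    by (rule arg_cong)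
  then show ?thesis
    unfolding midpoint_term_def u_def[symmetric] by (simp add: distrib_left)
qed

text \<open>Raising the order divides by u^2 >= 25, uniformly in k. The factor 1/25 passes to the
  coefficients and to the remainders of f, and gives all convergence statements at the
  midpoint.\<close>

lemma midpoint_term_decay:
  assumes "\<bar>t\<bar> \<le> 1"
  shows "- midpoint_term (Suc n) (k + 2) t \<le> - midpoint_term n (k + 2) t / 25"
proof -
  define u where "u = 2 * real (k + 2) + 1"
  have "5\<^sup>2 \<le> u\<^sup>2"
    unfolding u_def by (intro power_mono) auto
  moreover have "- midpoint_term n (k + 2) t = - midpoint_term (Suc n) (k + 2) t * u\<^sup>2"
    unfolding midpoint_term_def u_def[symmetric] by (simp add: u_def power2_eq_square)
  ultimately show ?thesis
    using midpoint_term_neg[OF assms, of "Suc n" k] mult_left_mono[of "5\<^sup>2" "u\<^sup>2" "- midpoint_term (Suc n) (k + 2) t"]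
    by simp
qed

text \<open>The coefficient of t^2 in \<open>f_term k\<close>, namely
  \<open>- 4 * pole_weight k / u ^ 3 + 1 / (2 * k + 2)\<close>, rewritten so that it sums to
  lambda(3), beta(3) and log 2.\<close>

definition quad_coeff :: "nat \<Rightarrow> real" where
  "quad_coeff k = (5 - 4 * (-1) ^ k) / (2 * real k + 1) ^ 3 - 1 / (2 * real k + 1) + 1 / (2 * real k + 2)"

text \<open>In the variable t the factor 1 + x(1 - x) is (5 - t^2)/4, so the harmonic part reaches
  only the constant and the t^2 coefficient, which makes b_0 and b_1 exceptional. From t^4 on only
  the poles contribute.\<close>

lemma f_term_midpoint:
  assumes "0 \<le> x" "x \<le> 1/2"
  shows "f_term (k + 2) x = f_term (k + 2) (1/2) + quad_coeff (k + 2) * (1 - 2 * x)\<^sup>2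
     + (1 - 2 * x) ^ 4 * midpoint_term 1 (k + 2) (1 - 2 * x)"
proof -
  define u where "u = 2 * real (k + 2) + 1"
  define e where "e = pole_weight (k + 2)"
  define r where "r = 1 / (2 * real (k + 2) + 2)"
  have u: "u \<ge> 5"
    by (simp add: u_def)
  have s: "4 * (-1) ^ k = 4 * e - u\<^sup>2 + 5"
    by (simp add: e_def u_def pole_weight_def power2_eq_square algebra_simps)
  have *: "f_term (k + 2) y = u - 4 * e * u / (u\<^sup>2 - (1 - 2 * y)\<^sup>2) - (5 - (1 - 2 * y)\<^sup>2) * r"
    if y: "0 \<le> y" "y \<le> 1/2" for y
  proof -
    define D where "D = u\<^sup>2 - (1 - 2 * y)\<^sup>2"
    have D: "D > 0"
      unfolding D_def using u y by (intro square_diff_pos) auto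
    have nz: "real k + 2 + y \<noteq> 0" "real k + 3 - y \<noteq> 0"
      using y by auto
    \<comment> \<open>With t = 1 - 2y the factors are u - t = 2(k + 2 + y) and u + t = 2(k + 3 -
      y).\<close>
    have D': "D = 4 * ((real k + 2 + y) * (real k + 3 - y))"
      by (simp add: D_def u_def power2_eq_square algebra_simps)
    have "1 / (real k + 2 + y) + 1 / (real k + 3 - y) = u / ((real k + 2 + y) * (real k + 3 - y))"
      using nz by (simp add: u_def add_frac_eq)
    also have "\<dots> = 4 * u / D"
      unfolding D' by simp
    finally have "1 / (real k + 2 + y) + 1 / (real k + 3 - y) = 4 * u / D" .
    moreover have "1 + y * (1 - y) - (-1) ^ k = (D - 4 * e) / 4"
      using s by (simp add: D_def power2_eq_square algebra_simps)
    ultimately have "f_term (k + 2) y = (D - 4 * e) / 4 * (4 * u / D) - 2 * (1 + y * (1 - y)) / (real k + 3)"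
      by (simp add: f_term_def add_ac)
    also have "(D - 4 * e) / 4 * (4 * u / D) = u - 4 * e * u / D"
      using D by (simp add: field_simps)
    also have "2 * (1 + y * (1 - y)) / (real k + 3) = (5 - (1 - 2 * y)\<^sup>2) * r"
    proof -
      have r: "r = 1 / (2 * (real k + 3))"
        by (simp add: r_def algebra_simps)
      have *: "5 - (1 - 2 * y)\<^sup>2 = 2 * (2 * (1 + y * (1 - y)))"
        by (simp add: power2_eq_square algebra_simps)
      have "2 * a / q = 2 * (2 * a) * (1 / (2 * q))" for a q :: real
        by simp
      then show ?thesis
        unfolding r * .
    qed
    finally show ?thesis
      by (simp add: D_def)
  qed
  define t where "t = 1 - 2 * x"
  have D: "u\<^sup>2 - t\<^sup>2 > 0"
    using assms u by (intro square_diff_pos) (auto simp: t_def)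
  have "u / (u\<^sup>2 - t\<^sup>2) = 1 / u + t\<^sup>2 * (1 / u ^ 3) + t ^ 4 * (1 / (u ^ 3 * (u\<^sup>2 - t\<^sup>2)))"
  proof -
    define d where "d = u\<^sup>2 - t\<^sup>2"
    have d: "d > 0" "u\<^sup>2 = d + t\<^sup>2"
      using D by (simp_all add: d_def)
    have "u / d = u\<^sup>2 / (u * d)"
      using u by (simp add: power2_eq_square)
    also have "\<dots> = 1 / u + t\<^sup>2 * (1 / (u * d))"
      unfolding d(2) using d(1) by (simp add: add_divide_distrib)
    also have "1 / (u * d) = 1 / u ^ 3 + t\<^sup>2 * (1 / (u ^ 3 * d))"
      using inverse_remainder[of u "u\<^sup>2" "- t\<^sup>2"] d u
      by (simp add: d_def power2_eq_square power3_eq_cube mult.assoc)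
    finally show ?thesis
      by (simp add: d_def distrib_left power2_eq_square power4_eq_xxxx)
  qed
  then have "4 * e * (u / (u\<^sup>2 - t\<^sup>2)) = 4 * e * (1 / u + t\<^sup>2 * (1 / u ^ 3) + t ^ 4 * (1 / (u ^ 3 * (u\<^sup>2 - t\<^sup>2))))"
    by (rule arg_cong)
  then have 1: "f_term (k + 2) x = u - 4 * e * (1 / u + t\<^sup>2 * (1 / u ^ 3) + t ^ 4 * (1 / (u ^ 3 * (u\<^sup>2 - t\<^sup>2)))) - (5 - t\<^sup>2) * r"
    using *[OF assms] by (simp add: t_def)
  have 2: "f_term (k + 2) (1/2) = u - 4 * e * (1 / u) - 5 * r"
    using *[of "1/2"] u by (simp add: power2_eq_square)
  have 3: "quad_coeff (k + 2) = - 4 * e * (1 / u ^ 3) + r"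
  proof -
    have "quad_coeff (k + 2) = (5 - 4 * (-1) ^ k) / u ^ 3 - 1 / u + r"
      by (simp add: quad_coeff_def u_def r_def)
    also have "(5 - 4 * (-1) ^ k) / u ^ 3 = (u\<^sup>2 - 4 * e) / u ^ 3"
      by (simp add: s)
    also have "\<dots> = 1 / u - 4 * e / u ^ 3"
      using u by (simp add: diff_divide_distrib power2_eq_square power3_eq_cube)
    finally show ?thesis
      by simp
  qed
  have 4: "midpoint_term 1 (k + 2) t = - 4 * e * (1 / (u ^ 3 * (u\<^sup>2 - t\<^sup>2)))"
    by (simp add: midpoint_term_def u_def e_def numeral_3_eq_3 numeral_2_eq_2)
  have "u - 4 * e * (a + t\<^sup>2 * b + t ^ 4 * c) - (5 - t\<^sup>2) * r
      = u - 4 * e * a - 5 * r + (- 4 * e * b + r) * t\<^sup>2 + t ^ 4 * (- 4 * e * c)" for a b c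
    by (simp add: algebra_simps)
  then show ?thesis
    unfolding t_def[symmetric] 1 2 3 4 .
qed

section \<open>Values of the coefficients b_n\<close>

lemma summable_odd_powers:
  assumes "n \<ge> 2"
  shows "summable (\<lambda>k. 1 / (2 * real k + 1) ^ n)"
proof (rule summable_comparison_test[OF _ summable_inverse_powers[OF assms]], intro exI allI impI)
  fix k :: nat
  show "norm (1 / (2 * real k + 1) ^ n) \<le> 1 / real (k + 1) ^ n"
    by (auto intro!: divide_left_mono power_mono mult_pos_pos)
qed

lemma lambda_nat_sums:
  "n \<ge> 2 \<Longrightarrow> (\<lambda>k. 1 / (2 * real k + 1) ^ n) sums lambda_nat n"
  using summable_sums[OF summable_odd_powers[of n]] by (simp add: lambda_nat_def add_ac)

lemma beta_nat_sums:
  assumes "n \<ge> 2"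
  shows "(\<lambda>k. (-1) ^ k / (2 * real k + 1) ^ n) sums beta_nat n"
proof -
  have "summable (\<lambda>k. (-1) ^ k / (2 * real k + 1) ^ n)"
    by (rule summable_norm_cancel) (use summable_odd_powers[OF assms] in \<open>simp add: power_abs\<close>)
  then show ?thesis
    using summable_sums by (fastforce simp add: beta_nat_def add_ac)
qed

text \<open>Splitting zeta(3) into odd and even denominators; needed because b_1 is given through 35
  zeta(3)/8 = 5 lambda(3).\<close>

lemma lambda_nat_3: "lambda_nat 3 = 7 / 8 * zeta_nat 3"
proof -
  have z: "(\<lambda>k. 1 / real (k + 1) ^ 3) sums zeta_nat 3"
    unfolding zeta_nat_def by (intro summable_sums summable_inverse_powers) simp
  have "(\<lambda>j. \<Sum>k = j * 2..<j * 2 + 2. 1 / real (k + 1) ^ 3) sums zeta_nat 3"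
    by (rule sums_group[OF z]) simp
  moreover have "(\<Sum>k = j * 2..<j * 2 + 2. 1 / real (k + 1) ^ 3)
      = 1 / (2 * real j + 1) ^ 3 + 1 / 8 * (1 / real (j + 1) ^ 3)" for j
  proof -
    have "{j * 2..<j * 2 + 2} = {2 * j, 2 * j + 1}"
      by auto
    moreover have "(2 * real j + 2) ^ 3 = 8 * real (j + 1) ^ 3"
      by (simp add: power3_eq_cube algebra_simps)
    ultimately show ?thesis
      by (simp add: add_ac)
  qed
  ultimately have "(\<lambda>j. 1 / (2 * real j + 1) ^ 3 + 1 / 8 * (1 / real (j + 1) ^ 3)) sums zeta_nat 3"
    by (simp only:)
  then have "zeta_nat 3 = lambda_nat 3 + 1 / 8 * zeta_nat 3"
    by (rule sums_unique2) (intro sums_add sums_mult z lambda_nat_sums, simp)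
  then show ?thesis
    by simp
qed

text \<open>The partial fractions of B at x = (1 - t)/2, prepared for the evaluation of
  beta(3).\<close>

lemma secant_sums:
  assumes "\<bar>t\<bar> < 1"
  shows "(\<lambda>k. (-1) ^ k * (4 * (2 * real k + 1) / ((2 * real k + 1)\<^sup>2 - t\<^sup>2))) sums (pi / cos (pi * t / 2))"
proof -
  let ?x = "(1 - t) / 2"
  have x: "0 < ?x" "?x < 1"
    using assms by auto
  have "1 / (real k + ?x) + 1 / (real k + 1 - ?x) = 4 * (2 * real k + 1) / ((2 * real k + 1)\<^sup>2 - t\<^sup>2)" for k
  proof -
    have "real k + ?x = ((2 * real k + 1) - t) / 2" "real k + 1 - ?x = ((2 * real k + 1) + t) / 2"
      by (simp_all add: field_simps)
    moreover have "(2 * real k + 1) - t > 0" "(2 * real k + 1) + t > 0"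
      using assms by auto
    moreover have "1 / ((u - t) / 2) + 1 / ((u + t) / 2) = 4 * u / (u\<^sup>2 - t\<^sup>2)"
      if "u - t > 0" "u + t > 0" for u :: real
    proof -
      have "u\<^sup>2 - t\<^sup>2 = (u - t) * (u + t)"
        by (simp add: power2_eq_square algebra_simps)
      then show ?thesis
        using that by (simp add: add_frac_eq)
    qed
    ultimately show ?thesis
      by metis
  qed
  moreover have "B_fun ?x = pi / cos (pi * t / 2)"
  proof -
    have "pi * ?x = pi / 2 - pi * t / 2"
      by (simp add: field_simps)
    then have "sin (pi * ?x) = sin (pi / 2 - pi * t / 2)"
      by (rule arg_cong)
    also have "\<dots> = cos (pi * t / 2)"
      using cos_sin_eq[of "pi * t / 2"] by simp
    finally have "sin (pi * ?x) = cos (pi * t / 2)" .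
    then show ?thesis
      by (simp only: B_fun_def Gamma_reflection_real)
  qed
  ultimately show ?thesis
    using B_fun_sums[OF x] by simp
qed

text \<open>Compares the quadratic coefficients at 0 in the partial fraction expansion of the secant.\<close>

lemma beta_nat_3: "beta_nat 3 = pi ^ 3 / 32"
proof -
  let ?Q = "\<lambda>t. (pi / cos (pi * t / 2) - pi) / (4 * t\<^sup>2)"
  \<comment> \<open>Termwise the difference is t^2 times a signed
    \<open>1 / (u ^ 3 * (u\<^sup>2 - t\<^sup>2))\<close> with u = 2k + 1; for t < 1/2 the last
    factor is at least 1/2, so 2 lambda(3) majorizes.\<close>
  have bound: "\<bar>?Q t - beta_nat 3\<bar> \<le> t\<^sup>2 * (2 * lambda_nat 3)" if t: "t \<in> {0<..<1/2}" for t
  proof -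
    let ?D = "\<lambda>k. (2 * real k + 1)\<^sup>2 - t\<^sup>2"
    have D: "?D k \<ge> 1/2" for k
    proof -
      have "1 \<le> (2 * real k + 1)\<^sup>2"
        by (intro one_le_power) simp
      moreover have "t\<^sup>2 \<le> (1/2)\<^sup>2"
        using t by (intro power_mono) auto
      ultimately show ?thesis
        by (simp add: power2_eq_square)
    qed
    have "(\<lambda>k. ((-1) ^ k * (4 * (2 * real k + 1) / ?D k) -
        (-1) ^ k * (4 * (2 * real k + 1) / ((2 * real k + 1)\<^sup>2 - 0\<^sup>2))) / (4 * t\<^sup>2)
        - (-1) ^ k / (2 * real k + 1) ^ 3) sums ((pi / cos (pi * t / 2) - pi / cos (pi * 0 / 2)) / (4 * t\<^sup>2) - beta_nat 3)"
      using t by (intro sums_diff sums_divide secant_sums beta_nat_sums) auto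
    moreover have "((-1) ^ k * (4 * (2 * real k + 1) / ?D k) -
        (-1) ^ k * (4 * (2 * real k + 1) / ((2 * real k + 1)\<^sup>2 - 0\<^sup>2))) / (4 * t\<^sup>2)
        - (-1) ^ k / (2 * real k + 1) ^ 3 = t\<^sup>2 * ((-1) ^ k / ((2 * real k + 1) ^ 3 * ?D k))" for k
    proof -
      have "(s * (4 * u / d) - s * (4 * u / (u\<^sup>2 - 0\<^sup>2))) / (4 * t\<^sup>2) - s / u ^ 3 = t\<^sup>2 * (s / (u ^ 3 * d))"
        if "d = u\<^sup>2 - t\<^sup>2" "d > 0" "u > 0" for s u d :: real
      proof -
        have "s * (4 * u / d) - s * (4 * u / (u\<^sup>2 - 0\<^sup>2)) = 4 * s * (u / d - 1 / u)"
          using that by (simp add: algebra_simps power2_eq_square)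
        also have "u / d - 1 / u = t\<^sup>2 / (u * d)"
          using that(2,3) by (simp add: field_simps) (simp add: that(1) power2_eq_square algebra_simps)
        also have "4 * s * (t\<^sup>2 / (u * d)) / (4 * t\<^sup>2) = s / (u * d)"
          using t by simp
        also have "s / (u * d) - s / u ^ 3 = s * (u\<^sup>2 - d) / (u ^ 3 * d)"
          using that(2,3) by (simp add: field_simps power2_eq_square power3_eq_cube)
        finally show ?thesis
          using that(1) by simp
      qed
      from this[of "?D k" "2 * real k + 1"] show ?thesis
        using D[of k] by simp
    qed
    ultimately have s: "(\<lambda>k. t\<^sup>2 * ((-1) ^ k / ((2 * real k + 1) ^ 3 * ?D k))) sums (?Q t - beta_nat 3)"
      by simp
    have b: "norm (t\<^sup>2 * ((-1) ^ k / ((2 * real k + 1) ^ 3 * ?D k))) \<le> t\<^sup>2 * (2 * (1 / (2 * real k + 1) ^ 3))" for k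
    proof -
      have "norm (t\<^sup>2 * ((-1) ^ k / ((2 * real k + 1) ^ 3 * ?D k))) = t\<^sup>2 * (1 / ((2 * real k + 1) ^ 3 * ?D k))"
        using D[of k] by (simp add: abs_mult power_abs)
      also have "1 / ((2 * real k + 1) ^ 3 * ?D k) \<le> 1 / ((2 * real k + 1) ^ 3 * (1/2))"
        using D[of k] by (intro divide_left_mono mult_left_mono mult_pos_pos) auto
      finally show ?thesis
        by (simp add: mult_left_mono)
    qed
    have l: "(\<lambda>k. t\<^sup>2 * (2 * (1 / (2 * real k + 1) ^ 3))) sums (t\<^sup>2 * (2 * lambda_nat 3))"
      by (intro sums_mult lambda_nat_sums) simp
    have "norm (\<Sum>k. t\<^sup>2 * ((-1) ^ k / ((2 * real k + 1) ^ 3 * ?D k))) \<le> (\<Sum>k. t\<^sup>2 * (2 * (1 / (2 * real k + 1) ^ 3)))"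
      by (rule norm_suminf_le[OF b]) (use l in \<open>simp only: sums_iff\<close>)
    then show ?thesis
      using s l by (simp add: sums_iff)
  qed
  have "(?Q \<longlongrightarrow> beta_nat 3) (at_right 0)"
  proof (rule LIM_zero_cancel, rule Lim_null_comparison)
    show "\<forall>\<^sub>F t in at_right 0. norm (?Q t - beta_nat 3) \<le> t\<^sup>2 * (2 * lambda_nat 3)"
      by (rule eventually_mono[OF eventually_at_right_real[of 0 "1/2"]]) (use bound in auto)
    have "((\<lambda>t::real. t\<^sup>2 * (2 * lambda_nat 3)) \<longlongrightarrow> 0\<^sup>2 * (2 * lambda_nat 3)) (at_right 0)"
      by (intro tendsto_intros)
    then show "((\<lambda>t::real. t\<^sup>2 * (2 * lambda_nat 3)) \<longlongrightarrow> 0) (at_right 0)"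
      by simp
  qed
  \<comment> \<open>The same quotient converges to pi^3/32 by the Taylor expansion of the
    cosine.\<close>
  then have "beta_nat 3 = pi * (pi * pi) / 32"
    by (rule tendsto_unique[OF trivial_limit_at_right_real]) real_asymp
  then show ?thesis
    by (simp add: power3_eq_cube)
qed

text \<open>The full series from k = 0 gives b_1. Its first two terms, 1/2 and 1/4, make up the t^2
  coefficient of \<open>1 - 3 * x + 3 * x\<^sup>2\<close> = 1/4 + 3 t^2/4.\<close>

lemma quad_coeff_sums: "(\<lambda>k. quad_coeff (k + 2)) sums (b_coeff 1 - 3/4)"
proof -
  have "(\<lambda>k. inverse (real (2 * k + 1)) - inverse (real (2 * k + 2))) sums ln 2"
    by (rule alternating_harmonic_series_sums')
  then have "(\<lambda>k. 1 / (2 * real k + 1) - 1 / (2 * real k + 2)) sums ln 2"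
    by (simp add: inverse_eq_divide add_ac)
  then have "(\<lambda>k. 5 * (1 / (2 * real k + 1) ^ 3) - 4 * ((-1) ^ k / (2 * real k + 1) ^ 3)
      - (1 / (2 * real k + 1) - 1 / (2 * real k + 2))) sums (5 * lambda_nat 3 - 4 * beta_nat 3 - ln 2)"
    by (intro sums_diff sums_mult lambda_nat_sums beta_nat_sums) auto
  moreover have "5 * (1 / (2 * real k + 1) ^ 3) - 4 * ((-1) ^ k / (2 * real k + 1) ^ 3)
      - (1 / (2 * real k + 1) - 1 / (2 * real k + 2)) = quad_coeff k" for k
    by (simp add: quad_coeff_def diff_divide_distrib)
  moreover have "5 * lambda_nat 3 - 4 * beta_nat 3 - ln 2 = b_coeff 1"
    by (simp add: b_coeff_def lambda_nat_3 beta_nat_3 diff_divide_distrib)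
  ultimately have "quad_coeff sums b_coeff 1"
    by simp
  note sums_split_initial_segment[OF this, of 2]
  moreover have "(\<Sum>k<2. quad_coeff k) = 3/4"
    by (simp add: quad_coeff_def numeral_2_eq_2 numeral_3_eq_3)
  ultimately show ?thesis
    by (simp only:)
qed

text \<open>Since the weight vanishes at 0 and 1, the sum may start at k = 0, where complete lambda
  and beta series appear. The case n = 0 would involve the divergent lambda(1).\<close>

lemma midpoint_term_0_sums:
  assumes "n \<ge> 1"
  shows "(\<lambda>k. midpoint_term n (k + 2) 0) sums b_coeff (n + 1)"
proof -
  have "(\<lambda>k. 5 * (1 / (2 * real k + 1) ^ (2 * n + 3)) - 1 / (2 * real k + 1) ^ (2 * n + 1)
      - 4 * ((-1) ^ k / (2 * real k + 1) ^ (2 * n + 3))) sums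
      (5 * lambda_nat (2 * n + 3) - lambda_nat (2 * n + 1) - 4 * beta_nat (2 * n + 3))"
    using assms by (intro sums_diff sums_mult lambda_nat_sums beta_nat_sums) auto
  moreover have "5 * lambda_nat (2 * n + 3) - lambda_nat (2 * n + 1) - 4 * beta_nat (2 * n + 3) = b_coeff (n + 1)"
    using assms by (simp add: b_coeff_def numeral_3_eq_3)
  moreover have "5 * (1 / (2 * real k + 1) ^ (2 * n + 3)) - 1 / (2 * real k + 1) ^ (2 * n + 1)
      - 4 * ((-1) ^ k / (2 * real k + 1) ^ (2 * n + 3)) = midpoint_term n k 0" for k
  proof -
    define u where "u = 2 * real k + 1"
    have u: "u > 0"
      by (simp add: u_def)
    have p: "u ^ (2 * n + 3) = u ^ (2 * n + 1) * u\<^sup>2"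
    proof -
      have "2 * n + 3 = (2 * n + 1) + 2"
        by simp
      then show ?thesis
        by (simp only: power_add)
    qed
    have "1 / u ^ (2 * n + 1) = u\<^sup>2 / u ^ (2 * n + 3)"
      unfolding p using u by simp
    moreover have e: "- 4 * pole_weight k = 5 - u\<^sup>2 - 4 * (-1) ^ k"
      by (simp add: u_def pole_weight_def power2_eq_square algebra_simps)
    have "midpoint_term n k 0 = (5 - u\<^sup>2 - 4 * (-1) ^ k) / u ^ (2 * n + 3)"
      unfolding midpoint_term_def u_def[symmetric] p e[symmetric] by simp
    ultimately show ?thesis
      unfolding u_def[symmetric] by (simp only: diff_divide_distrib)
  qed
  ultimately have "(\<lambda>k. midpoint_term n k 0) sums b_coeff (n + 1)"
    by simp
  moreover have "(\<Sum>k<2. midpoint_term n k 0) = 0"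
    by (simp add: midpoint_term_def pole_weight_def numeral_2_eq_2)
  ultimately show ?thesis
    using sums_split_initial_segment[of "\<lambda>k. midpoint_term n k 0" "b_coeff (n + 1)" 2] by simp
qed

lemma b_coeff_neg: "n \<ge> 2 \<Longrightarrow> b_coeff n < 0"
  using sums_pos[OF sums_minus[OF midpoint_term_0_sums[of "n - 1"]]] midpoint_term_neg[of 0 "n - 1"]
  by (simp add: Suc_le_eq)

lemma b_coeff_decay:
  assumes "n \<ge> 2"
  shows "- b_coeff (Suc n) \<le> - b_coeff n / 25"
proof (rule sums_le)
  show "(\<lambda>k. - midpoint_term n (k + 2) 0) sums (- b_coeff (Suc n))"
    using midpoint_term_0_sums[of n] assms by (intro sums_minus) auto
  show "(\<lambda>k. - midpoint_term (n - 1) (k + 2) 0 / 25) sums (- b_coeff n / 25)"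
    using midpoint_term_0_sums[of "n - 1"] assms by (intro sums_divide sums_minus) auto
  show "- midpoint_term n (k + 2) 0 \<le> - midpoint_term (n - 1) (k + 2) 0 / 25" for k
    using midpoint_term_decay[of 0 "n - 1" k] assms by (simp add: Suc_diff_le)
qed

text \<open>The singularity of \<^const>\<open>f_fun\<close> at 0 is removable, with value 1.\<close>

definition f_ext :: "real \<Rightarrow> real" where
  "f_ext x = (if x = 0 then 1 else f_fun x)"

section \<open>The power series of f at the midpoint\<close>

lemma f_ext_sums:
  assumes "0 \<le> x" "x \<le> 1/2"
  shows "(\<lambda>k. f_term (k + 2) x) sums (f_ext x - (1 - 3 * x + 3 * x\<^sup>2))"
  using f_fun_sums_shift2[of x] f_term_0_sums assms by (auto simp: f_ext_def)

text \<open>Including x = 0, that is t = 1, is what later identifies the value of the series at t =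
  1 with c_n.\<close>

lemma f_ext_remainder_sums:
  assumes x: "0 \<le> x" "x < 1/2" and n: "n \<ge> 1"
  shows "(\<lambda>k. midpoint_term n (k + 2) (1 - 2 * x)) sums ((f_ext x - S_poly n x) / (1 - 2 * x) ^ (2 * (n + 1)))"
proof -
  let ?t = "1 - 2 * x"
  have t: "?t \<noteq> 0" "\<bar>?t\<bar> \<le> 1"
    using x by auto
  show ?thesis
    using n
  proof (induction n rule: dec_induct)
    case base
    have "f_ext (1/2) = b_coeff 0"
      by (simp add: f_ext_def f_fun_half)
    then have "(\<lambda>k. (f_term (k + 2) x - f_term (k + 2) (1/2) - quad_coeff (k + 2) * ?t\<^sup>2) / ?t ^ 4) sums
        ((f_ext x - (1 - 3 * x + 3 * x\<^sup>2) - (b_coeff 0 - (1 - 3 * (1/2) + 3 * (1/2)\<^sup>2))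
          - (b_coeff 1 - 3/4) * ?t\<^sup>2) / ?t ^ 4)"
      using f_ext_sums[of "1/2"] f_ext_sums[of x] x
      by (intro sums_divide sums_diff sums_mult2 quad_coeff_sums) auto
    moreover have "(f_term (k + 2) x - f_term (k + 2) (1/2) - quad_coeff (k + 2) * ?t\<^sup>2) / ?t ^ 4
        = midpoint_term 1 (k + 2) ?t" for k
      using x t by (subst f_term_midpoint) auto
    moreover have "f_ext x - (1 - 3 * x + 3 * x\<^sup>2) - (b_coeff 0 - (1 - 3 * (1/2) + 3 * (1/2)\<^sup>2))
          - (b_coeff 1 - 3/4) * ?t\<^sup>2 = f_ext x - S_poly 1 x"
      by (simp add: S_poly_def power2_eq_square algebra_simps)
    moreover have "2 * (1 + 1) = (4::nat)"
      by simp
    ultimately show ?case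
      by (simp only:)
  next
    case (step n)
    have "(\<lambda>k. (midpoint_term n (k + 2) ?t - midpoint_term n (k + 2) 0) / ?t\<^sup>2) sums
        (((f_ext x - S_poly n x) / ?t ^ (2 * (n + 1)) - b_coeff (n + 1)) / ?t\<^sup>2)"
      using step by (intro sums_divide sums_diff midpoint_term_0_sums) auto
    moreover have "(midpoint_term n (k + 2) ?t - midpoint_term n (k + 2) 0) / ?t\<^sup>2 = midpoint_term (Suc n) (k + 2) ?t" for k
      using t by (subst midpoint_term_step) auto
    moreover have "((f_ext x - S_poly n x) / ?t ^ (2 * (n + 1)) - b_coeff (n + 1)) / ?t\<^sup>2
        = (f_ext x - S_poly (Suc n) x) / ?t ^ (2 * (Suc n + 1))"
    proof -
      have "?t ^ (2 * (Suc n + 1)) = ?t ^ (2 * (n + 1)) * ?t\<^sup>2"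
        by (simp only: power_add[symmetric]) simp
      moreover have "S_poly (Suc n) x = S_poly n x + b_coeff (n + 1) * ?t ^ (2 * (n + 1))"
        by (simp add: S_poly_def)
      moreover have "(a / p - b) / q = (a - b * p) / (p * q)" if "p \<noteq> 0" for a b p q :: real
        using that by (simp add: diff_divide_distrib)
      ultimately show ?thesis
        using t(1) by (simp only: diff_diff_eq power_not_zero not_False_eq_True)
    qed
    ultimately show ?case
      by simp
  qed
qed

text \<open>With r n the negated quotient from \<open>f_ext_remainder_sums\<close>, the error of the
  partial sum is r n times a power of t in [0,1], and r shrinks at least by the factor 25 per step.
  The point x = 1/2 is separate because r divides by powers of t.\<close>

lemma f_ext_power_series:
  assumes x: "0 \<le> x" "x \<le> 1/2"
  shows "(\<lambda>j. b_coeff j * (1 - 2 * x) ^ (2 * j)) sums f_ext x"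
proof (cases "x = 1/2")
  case True
  have "S_poly n (1/2) = f_ext (1/2)" for n
  proof -
    have "S_poly n (1/2) = (\<Sum>k=0..n. if k = 0 then b_coeff k else 0)"
      unfolding S_poly_def by (rule sum.cong) auto
    then show ?thesis
      by (simp add: f_ext_def f_fun_half)
  qed
  then show ?thesis
    unfolding sums_def' True S_poly_def by simp
next
  case False
  let ?t = "1 - 2 * x"
  have t: "0 < ?t" "\<bar>?t\<bar> \<le> 1"
    using x False by auto
  define r where "r n = - ((f_ext x - S_poly n x) / ?t ^ (2 * (n + 1)))" for n
  have r_sums: "(\<lambda>k. - midpoint_term n (k + 2) ?t) sums r n" if "n \<ge> 1" for n
    unfolding r_def using that x False by (intro sums_minus f_ext_remainder_sums) auto
  have r_pos: "r n > 0" if "n \<ge> 1" for n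
    by (rule sums_pos[OF r_sums[OF that]]) (use midpoint_term_neg t in simp)
  have r_decay: "r (Suc n) \<le> r n / 25" if "n \<ge> 1" for n
    by (rule sums_le[OF _ r_sums sums_divide[OF r_sums]]) (use midpoint_term_decay t that in auto)
  have r_bound: "r (Suc n) \<le> r 1 * (1/25) ^ n" for n
  proof (induction n)
    case (Suc n)
    then show ?case
      using r_decay[of "Suc n"] by simp
  qed simp
  have "(\<lambda>n. S_poly (Suc n) x - f_ext x) \<longlonglongrightarrow> 0"
  proof (rule Lim_null_comparison)
    show "\<forall>\<^sub>F n in sequentially. norm (S_poly (Suc n) x - f_ext x) \<le> r 1 * (1/25) ^ n"
    proof (intro always_eventually allI)
      fix n
      have "S_poly (Suc n) x - f_ext x = r (Suc n) * ?t ^ (2 * (Suc n + 1))"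
        using t by (simp add: r_def)
      moreover have "0 \<le> ?t ^ (2 * (Suc n + 1))" "?t ^ (2 * (Suc n + 1)) \<le> 1"
        using t by (auto intro!: power_le_one zero_le_power simp del: power_Suc)
      ultimately have "norm (S_poly (Suc n) x - f_ext x) \<le> r (Suc n)"
        using r_pos[of "Suc n"] by (simp add: abs_mult mult_left_le del: power_Suc)
      with r_bound[of n] show "norm (S_poly (Suc n) x - f_ext x) \<le> r 1 * (1/25) ^ n"
        by linarith
    qed
    have "(\<lambda>n. r 1 * (1/25) ^ n) \<longlonglongrightarrow> r 1 * 0"
      by (intro tendsto_mult tendsto_const LIMSEQ_power_zero) auto
    then show "(\<lambda>n. r 1 * (1/25) ^ n) \<longlonglongrightarrow> 0"
      by simp
  qed
  then have "(\<lambda>n. S_poly n x - f_ext x) \<longlonglongrightarrow> 0"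
    by (rule LIMSEQ_imp_Suc)
  then show ?thesis
    unfolding sums_def' S_poly_def[symmetric] by (rule LIM_zero_cancel)
qed

text \<open>A series in t with vanishing odd coefficients, rather than one in t^2, so that
  \<open>diffs\<close> and termwise differentiation apply directly.\<close>

definition g_coeff :: "nat \<Rightarrow> nat \<Rightarrow> real" where
  "g_coeff n i = (if even i then b_coeff (n + 1 + i div 2) else 0)"

lemma g_coeff_nonpos: "i \<ge> 1 \<Longrightarrow> g_coeff n i \<le> 0"
  using b_coeff_neg[of "n + 1 + i div 2"] by (auto simp: g_coeff_def elim!: evenE)

text \<open>The radius 2 is a choice between 1 and 5: derivatives up to t = 1 require more than 1,
  and the decay of the coefficients by 1/25 per factor t^2 permits anything below 5. Here the ratio
  is 4/25.\<close>

lemma g_coeff_summable: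
  assumes "\<bar>t\<bar> < 2"
  shows "summable (\<lambda>i. g_coeff n i * t ^ i)"
proof -
  have "summable (\<lambda>j. b_coeff (n + 1 + j) * 4 ^ j)"
  proof (rule summable_ratio_test)
    fix j :: nat assume "j \<ge> 1"
    then have "\<bar>b_coeff (Suc (n + 1 + j))\<bar> \<le> \<bar>b_coeff (n + 1 + j)\<bar> / 25"
      using b_coeff_decay[of "n + 1 + j"] b_coeff_neg[of "n + 1 + j"] b_coeff_neg[of "Suc (n + 1 + j)"]
      by simp
    then have "\<bar>b_coeff (Suc (n + 1 + j))\<bar> * 4 ^ Suc j \<le> \<bar>b_coeff (n + 1 + j)\<bar> / 25 * 4 ^ Suc j"
      by (rule mult_right_mono) simp
    then show "norm (b_coeff (n + 1 + Suc j) * 4 ^ Suc j) \<le> 4/25 * norm (b_coeff (n + 1 + j) * 4 ^ j)"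
      by (simp add: abs_mult)
  qed simp
  then have "summable (\<lambda>j. g_coeff n (2 * j) * 2 ^ (2 * j))"
    by (simp add: g_coeff_def power_mult)
  then have "summable (\<lambda>i. g_coeff n i * 2 ^ i)"
  proof (subst (asm) summable_mono_reindex)
    show "strict_mono ((*) (2::nat))"
      by (simp add: strict_mono_def)
    show "g_coeff n i * 2 ^ i = 0" if "i \<notin> range ((*) 2)" for i
      using that by (auto simp: g_coeff_def elim!: evenE)
  qed
  then show ?thesis
    by (rule powser_inside) (use assms in simp)
qed

section \<open>Termwise derivatives and their signs\<close>

definition g_series :: "nat \<Rightarrow> nat \<Rightarrow> real \<Rightarrow> real" where
  "g_series n m t = (\<Sum>i. (diffs ^^ m) (g_coeff n) i * t ^ i)"

text \<open>The factor p is (i + m)!/i!, of which only the sign is used.\<close>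

lemma diffs_power_eq: "\<exists>p>0. (diffs ^^ m) c i = p * (c (i + m) :: real)"
proof (induction m arbitrary: i)
  case 0
  show ?case
    by (intro exI[of _ 1]) simp
next
  case (Suc m)
  then obtain p where "p > 0" "(diffs ^^ m) c (Suc i) = p * c (Suc i + m)"
    by blast
  then show ?case
    by (intro exI[of _ "real (Suc i) * p"]) (simp add: diffs_def[of "(diffs ^^ m) c"])
qed

lemma diffs_g_coeff_summable:
  assumes "\<bar>t\<bar> < 2"
  shows "summable (\<lambda>i. (diffs ^^ m) (g_coeff n) i * t ^ i)"
  using assms
proof (induction m arbitrary: t)
  case 0
  then show ?case
    using g_coeff_summable by simp
next
  case (Suc m)
  have "summable (\<lambda>i. diffs ((diffs ^^ m) (g_coeff n)) i * t ^ i)"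
    by (rule termdiff_converges[of t 2]) (use Suc in auto)
  then show ?case
    by simp
qed

lemma g_series_has_derivative:
  assumes "\<bar>t\<bar> < 2"
  shows "(g_series n m has_real_derivative g_series n (Suc m) t) (at t)"
  unfolding g_series_def[abs_def] funpow.simps o_apply
  by (rule termdiffs_strong'[of 2]) (use assms diffs_g_coeff_summable in auto)

text \<open>Differentiation removes the constant coefficient b_{n+1}, the only one whose sign
  \<open>b_coeff_neg\<close> may leave open: for n = 0 it is b_1.\<close>

lemma g_series_neg:
  assumes "m \<ge> 1" "0 < t" "t < 2"
  shows "g_series n m t < 0"
proof -
  let ?f = "\<lambda>i. - ((diffs ^^ m) (g_coeff n) i * t ^ i)"
  have "0 < suminf ?f"
  \<comment> \<open>At index m the coefficient is a multiple of \<open>g_coeff n (2 * m)\<close>;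
    the even index makes it nonzero.\<close>
  proof (rule suminf_pos2[of _ m])
    show "summable ?f"
      using assms by (intro summable_minus diffs_g_coeff_summable) auto
    show "0 \<le> ?f i" for i
    proof -
      obtain p where p: "p > 0" "(diffs ^^ m) (g_coeff n) i = p * g_coeff n (i + m)"
        using diffs_power_eq by blast
      have "g_coeff n (i + m) \<le> 0"
        using assms by (intro g_coeff_nonpos) auto
      then have "p * g_coeff n (i + m) * t ^ i \<le> 0"
        using p assms by (intro mult_nonpos_nonneg mult_nonneg_nonpos) auto
      then show ?thesis
        using p by simp
    qed
    obtain p where p: "p > 0" "(diffs ^^ m) (g_coeff n) m = p * g_coeff n (m + m)"
      using diffs_power_eq by blast
    have "g_coeff n (m + m) < 0"
      using assms b_coeff_neg[of "n + 1 + m"] by (simp add: g_coeff_def)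
    then have "p * g_coeff n (m + m) * t ^ m < 0"
      using p assms by (intro mult_neg_pos mult_pos_neg) auto
    then show "0 < ?f m"
      using p by simp
  qed
  moreover have "suminf ?f = - g_series n m t"
    unfolding g_series_def using assms by (intro suminf_minus diffs_g_coeff_summable) auto
  ultimately show ?thesis
    by simp
qed

lemma f_ext_tail:
  assumes "0 \<le> x" "x \<le> 1/2"
  shows "f_ext x = S_poly n x + (1 - 2 * x) ^ (2 * (n + 1)) * g_series n 0 (1 - 2 * x)"
proof -
  let ?t = "1 - 2 * x"
  have "summable (\<lambda>i. g_coeff n i * ?t ^ i)"
    using assms by (intro g_coeff_summable) auto
  then have "(\<lambda>i. g_coeff n i * ?t ^ i) sums g_series n 0 ?t"
    by (simp add: g_series_def summable_sums)
  then have "(\<lambda>j. g_coeff n (2 * j) * ?t ^ (2 * j)) sums g_series n 0 ?t"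
  proof (subst sums_mono_reindex)
    show "strict_mono ((*) (2::nat))"
      by (simp add: strict_mono_def)
    show "g_coeff n i * ?t ^ i = 0" if "i \<notin> range ((*) 2)" for i
      using that by (auto simp: g_coeff_def elim!: evenE)
  qed
  from sums_mult[OF this, of "?t ^ (2 * (n + 1))"]
  have 1: "(\<lambda>j. b_coeff (j + Suc n) * ?t ^ (2 * (j + Suc n))) sums (?t ^ (2 * (n + 1)) * g_series n 0 ?t)"
    by (simp add: g_coeff_def algebra_simps power_add)
  have 2: "(\<lambda>j. b_coeff (j + Suc n) * ?t ^ (2 * (j + Suc n))) sums
      (f_ext x - (\<Sum>j<Suc n. b_coeff j * ?t ^ (2 * j)))"
    using assms by (intro sums_split_initial_segment f_ext_power_series) auto
  have "(\<Sum>j<Suc n. b_coeff j * ?t ^ (2 * j)) = S_poly n x"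
    by (simp only: S_poly_def lessThan_Suc_atMost atMost_atLeast0)
  with sums_unique2[OF 1 2] show ?thesis
    by linarith
qed

lemma g_rem_eq:
  assumes "x \<in> {0<..<1/2}"
  shows "g_rem n x = g_series n 0 (1 - 2 * x)"
  using f_ext_tail[of x n] assms by (simp add: g_rem_def f_ext_def)

lemma g_series_0: "g_series n 0 0 = b_coeff (n + 1)"
  using powser_zero[of "g_coeff n"] by (simp add: g_series_def g_coeff_def)

text \<open>The source of c_n: at t = 1 the function takes its removable value 1 at x = 0, and all
  powers of t in S_n are 1.\<close>

lemma g_series_1: "g_series n 0 1 = c_const n"
  using f_ext_tail[of 0 n] by (simp add: f_ext_def c_const_def S_poly_def)

section \<open>Complete monotonicity, concavity and range of g_n\<close>

lemma higher_deriv_eq_on_open: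
  fixes D :: "nat \<Rightarrow> real \<Rightarrow> real"
  assumes "open S" "\<And>x. x \<in> S \<Longrightarrow> \<phi> x = D 0 x"
    and D: "\<And>j x. x \<in> S \<Longrightarrow> (D j has_real_derivative D (Suc j) x) (at x)"
    and "x \<in> S"
  shows "((deriv ^^ j) \<phi> has_real_derivative D (Suc j) x) (at x)" "(deriv ^^ j) \<phi> x = D j x"
proof -
  have *: "\<forall>x\<in>S. (deriv ^^ j) \<phi> x = D j x" for j
  proof (induction j)
    case (Suc j)
    show ?case
    proof
      fix x assume x: "x \<in> S"
      have "((deriv ^^ j) \<phi> has_real_derivative D (Suc j) x) (at x)"
        by (rule has_field_derivative_transform_within_open[OF D[OF x] \<open>open S\<close> x]) (use Suc in simp)
      then show "(deriv ^^ Suc j) \<phi> x = D (Suc j) x"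
        by (simp add: DERIV_imp_deriv)
    qed
  qed (use assms in simp)
  show "(deriv ^^ j) \<phi> x = D j x"
    using * \<open>x \<in> S\<close> by blast
  show "((deriv ^^ j) \<phi> has_real_derivative D (Suc j) x) (at x)"
    by (rule has_field_derivative_transform_within_open[OF D \<open>open S\<close>]) (use * \<open>x \<in> S\<close> in simp_all)
qed

lemma g_rem_higher_deriv:
  assumes "x \<in> {0<..<1/2}"
  shows "((deriv ^^ m) (g_rem n) has_real_derivative (-2) ^ Suc m * g_series n (Suc m) (1 - 2 * x)) (at x)"
    "(deriv ^^ m) (g_rem n) x = (-2) ^ m * g_series n m (1 - 2 * x)"
proof -
  have D: "((\<lambda>x. (-2) ^ j * g_series n j (1 - 2 * x)) has_real_derivative
      (-2) ^ Suc j * g_series n (Suc j) (1 - 2 * x)) (at x)" if "x \<in> {0<..<1/2}" for x j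
  proof -
    have "((\<lambda>x. g_series n j (1 - 2 * x)) has_real_derivative g_series n (Suc j) (1 - 2 * x) * (- 2)) (at x)"
      by (rule DERIV_chain2[OF g_series_has_derivative])
        (use that in \<open>auto intro!: derivative_eq_intros\<close>)
    from DERIV_cmult[OF this, of "(-2) ^ j"] show ?thesis
      by (simp add: mult_ac)
  qed
  show "((deriv ^^ m) (g_rem n) has_real_derivative (-2) ^ Suc m * g_series n (Suc m) (1 - 2 * x)) (at x)"
    "(deriv ^^ m) (g_rem n) x = (-2) ^ m * g_series n m (1 - 2 * x)"
    using higher_deriv_eq_on_open[of "{0<..<1/2}" "g_rem n" "\<lambda>j x. (-2) ^ j * g_series n j (1 - 2 * x)" x m]
      D assms g_rem_eq by auto
qed

text \<open>The inner derivative of 1 - 2x contributes (-2)^(m+j). Together with (-1)^j and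
  (-1)^(m+1) this is -2^(m+j), which meets the negative derivative of order m + j >= 1 of the
  series.\<close>

lemma G_fun_strictly_completely_monotonic:
  "strictly_completely_monotonic_on {0<..<1/2} (G_fun n m)"
proof -
  define D where "D j x = (-1) ^ (m + 1) * (deriv ^^ (m + j)) (g_rem n) x" for j x
  have D0: "D 0 = G_fun n m"
    by (simp add: fun_eq_iff D_def G_fun_def)
  have D: "(D j has_real_derivative D (Suc j) x) (at x)" if "x \<in> {0<..<1/2}" for j x
    unfolding D_def[abs_def] add_Suc_right
    using DERIV_cmult[OF g_rem_higher_deriv(1)[OF that], of "(-1) ^ (m + 1)" "m + j" n]
    by (simp only: g_rem_higher_deriv(2)[OF that])
  show ?thesis
    unfolding strictly_completely_monotonic_on_def smooth_on_interval_def
  proof (intro conjI exI[of _ D] allI ballI impI D0)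
    show "(D j has_real_derivative D (Suc j) x) (at x within {0<..<1/2})" if "x \<in> {0<..<1/2}" for j x
      using D[OF that] by (rule has_field_derivative_at_within)
    fix j :: nat and x :: real
    assume j: "1 \<le> j" and "x \<in> interior {0<..<1/2}"
    then have x: "x \<in> {0<..<1/2}"
      by (simp add: interior_open)
    have "(deriv ^^ j) (G_fun n m) x = D j x"
      using higher_deriv_eq_on_open(2)[of "{0<..<1/2}" "G_fun n m" D x j] D0 D x by auto
    also have "\<dots> = (-1) ^ (m + 1) * ((-2) ^ (m + j) * g_series n (m + j) (1 - 2 * x))"
      by (simp only: D_def g_rem_higher_deriv(2)[OF x])
    finally have "(-1) ^ j * (deriv ^^ j) (G_fun n m) x
        = ((-1) ^ (m + j) * (-2) ^ (m + j)) * (- g_series n (m + j) (1 - 2 * x))"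
      by (simp add: power_add)
    also have "(-1) ^ (m + j) * (-2) ^ (m + j) = (2::real) ^ (m + j)"
      by (simp flip: power_mult_distrib)
    finally show "0 < (-1) ^ j * (deriv ^^ j) (G_fun n m) x"
      using g_series_neg[of "m + j" "1 - 2 * x" n] j x by (simp add: mult_pos_neg)
  qed
qed

lemma g_rem_strict_mono: "strict_mono_on {0<..<1/2} (g_rem n)"
proof (rule strict_mono_onI)
  fix x y :: real assume xy: "x \<in> {0<..<1/2}" "y \<in> {0<..<1/2}" "x < y"
  show "g_rem n x < g_rem n y"
  proof (rule DERIV_pos_imp_increasing[OF \<open>x < y\<close>])
    fix z assume "x \<le> z" "z \<le> y"
    then have z: "z \<in> {0<..<1/2}"
      using xy by auto
    have "0 < (-2) ^ Suc 0 * g_series n (Suc 0) (1 - 2 * z)"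
      using g_series_neg[of "Suc 0" "1 - 2 * z" n] z by simp
    then show "\<exists>d. (g_rem n has_real_derivative d) (at z) \<and> 0 < d"
      using g_rem_higher_deriv(1)[OF z, of 0 n] by auto
  qed
qed

lemma g_rem_concave: "concave_on {0<..<1/2} (g_rem n)"
proof (rule f''_le0_imp_concave)
  fix z :: real assume z: "z \<in> {0<..<1/2}"
  show "(g_rem n has_real_derivative deriv (g_rem n) z) (at z)"
    using g_rem_higher_deriv(1)[OF z, of 0 n] g_rem_higher_deriv(2)[OF z, of 1 n] by simp
  show "(deriv (g_rem n) has_real_derivative (-2) ^ 2 * g_series n 2 (1 - 2 * z)) (at z)"
    using g_rem_higher_deriv(1)[OF z, of 1 n] by (simp add: numeral_2_eq_2)
  show "(-2) ^ 2 * g_series n 2 (1 - 2 * z) \<le> 0"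
    using g_series_neg[of 2 "1 - 2 * z" n] z by simp
qed simp

lemma g_series_continuous: "continuous_on {0..1} (g_series n m)"
  by (intro continuous_at_imp_continuous_on ballI DERIV_isCont[OF g_series_has_derivative]) auto

text \<open>The series is even in t, so its derivative vanishes at t = 0; the sign is therefore used
  on the open interval only, with continuity at the ends.\<close>

lemma g_series_strict_decreasing:
  assumes "0 \<le> s" "s < t" "t \<le> 1"
  shows "g_series n 0 t < g_series n 0 s"
proof (rule DERIV_neg_imp_decreasing_open[OF assms(2)])
  fix z assume z: "s < z" "z < t"
  then have "g_series n (Suc 0) z < 0"
    using assms by (intro g_series_neg) auto
  then show "\<exists>d. (g_series n 0 has_real_derivative d) (at z) \<and> d < 0"
    using g_series_has_derivative[of z n 0] z assms by auto
next
  show "continuous_on {s..t} (g_series n 0)"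
    using assms by (intro continuous_on_subset[OF g_series_continuous]) auto
qed

lemma g_rem_image: "g_rem n ` {0<..<1/2} = {c_const n<..<b_coeff (n + 1)}"
proof (intro equalityI subsetI)
  fix y assume "y \<in> g_rem n ` {0<..<1/2}"
  then obtain x where "x \<in> {0<..<1/2}" "y = g_series n 0 (1 - 2 * x)"
    using g_rem_eq by auto
  then show "y \<in> {c_const n<..<b_coeff (n + 1)}"
    using g_series_strict_decreasing[of 0 "1 - 2 * x" n] g_series_strict_decreasing[of "1 - 2 * x" 1 n]
    by (simp add: g_series_0 g_series_1)
next
  fix y assume y: "y \<in> {c_const n<..<b_coeff (n + 1)}"
  have "\<exists>t\<ge>0. t \<le> 1 \<and> g_series n 0 t = y"
    using y by (intro IVT2' g_series_continuous) (auto simp: g_series_0 g_series_1)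
  then obtain t where t: "0 \<le> t" "t \<le> 1" "g_series n 0 t = y"
    by blast
  with y have "t \<noteq> 0" "t \<noteq> 1"
    by (auto simp: g_series_0 g_series_1)
  with t have "(1 - t) / 2 \<in> {0<..<1/2}"
    by auto
  moreover have "1 - 2 * ((1 - t) / 2) = t"
    by (simp add: field_simps)
  then have "g_rem n ((1 - t) / 2) = y"
    unfolding g_rem_eq[OF \<open>(1 - t) / 2 \<in> {0<..<1/2}\<close>] t(3)[symmetric] by (rule arg_cong)
  ultimately show "y \<in> g_rem n ` {0<..<1/2}"
    by (metis imageI)
qed

text \<open>The tail after S_{n+1} is t^(2n+4) h(t), where h decreases from h(0) = b_{n+2} < 0 to
  h(1) = c_{n+1}. For 0 < t < 1 negativity gives t h(t) > h(t) > h(1), hence the odd exponent 2n + 3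
  in the lower bound.\<close>

lemma f_fun_bounds_midpoint:
  assumes x: "0 < x" "x \<le> 1/2"
  shows "S_poly (n + 1) x + c_const (n + 1) * (1 - 2 * x) ^ (2 * n + 3) \<le> f_fun x" (is ?L)
    "S_poly (n + 1) x + c_const (n + 1) * (1 - 2 * x) ^ (2 * n + 3) = f_fun x \<longleftrightarrow> x = 1/2" (is ?EL)
    "f_fun x \<le> S_poly (n + 1) x" (is ?U)
    "f_fun x = S_poly (n + 1) x \<longleftrightarrow> x = 1/2" (is ?EU)
proof -
  let ?t = "1 - 2 * x" and ?h = "g_series (n + 1) 0"
  have f: "f_fun x = S_poly (n + 1) x + ?t ^ (2 * n + 3) * (?t * ?h ?t)"
    using f_ext_tail[of x "n + 1"] x by (simp add: f_ext_def numeral_3_eq_3 mult_ac)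
  have "?L \<and> ?EL \<and> ?U \<and> ?EU"
  proof (cases "x = 1/2")
    case True
    show ?thesis
      using f unfolding True by (simp add: power_0_left)
  next
    case False
    then have t: "0 < ?t" "?t < 1"
      using x by auto
    have "?h ?t < 0"
      using g_series_strict_decreasing[of 0 ?t "n + 1"] t b_coeff_neg[of "n + 2"] by (simp add: g_series_0)
    moreover have "?h 1 < ?h ?t"
      using g_series_strict_decreasing[of ?t 1 "n + 1"] t by simp
    moreover from \<open>?h ?t < 0\<close> have "1 * ?h ?t < ?t * ?h ?t" "?t * ?h ?t < 0"
      using t by (intro mult_strict_right_mono_neg mult_pos_neg; simp)+
    ultimately have "?h 1 < ?t * ?h ?t" "?t * ?h ?t < 0"
      by linarith+
    moreover have "?t ^ (2 * n + 3) > 0"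
      using t by simp
    ultimately have "?t ^ (2 * n + 3) * ?h 1 < ?t ^ (2 * n + 3) * (?t * ?h ?t)"
      "?t ^ (2 * n + 3) * (?t * ?h ?t) < 0"
      by (auto intro: mult_strict_left_mono mult_pos_neg)
    then have "S_poly (n + 1) x + c_const (n + 1) * ?t ^ (2 * n + 3) < f_fun x" "f_fun x < S_poly (n + 1) x"
      unfolding f g_series_1 mult.commute[of "c_const (n + 1)"] by linarith+
    with False show ?thesis
      by simp
  qed
  then show ?L ?EL ?U ?EU
    by auto
qed

lemma R_fun_bounds_midpoint:
  assumes x: "0 < x" "x \<le> 1/2"
  shows "(let L = (B_fun x + S_poly (n + 1) x + c_const (n + 1) * (1 - 2 * x) ^ (2 * n + 3)) / (1 + x * (1 - x));
              U = (B_fun x + S_poly (n + 1) x) / (1 + x * (1 - x))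
          in L \<le> R_fun x \<and> R_fun x \<le> U \<and> (L = R_fun x \<longleftrightarrow> x = 1/2) \<and> (R_fun x = U \<longleftrightarrow> x = 1/2))"
  unfolding Let_def add.assoc[of "B_fun x"] by (intro R_fun_bounds x f_fun_bounds_midpoint)

theorem theorem1p2:
  shows
   "(strict_mono_on {0<..1/2} (f_rem 0) \<and> convex_on {0<..1/2} (f_rem 0) \<and>
       f_rem 0 ` {0<..1/2} = {a_coeff 1 <.. 2 * (b_coeff 0 - 1)})
    \<and>
    (\<forall>n\<ge>1.
       strict_mono_on {0<..1/2} (f_rem (2 * n - 1)) \<and>
       concave_on {0<..1/2} (f_rem (2 * n - 1)) \<and>
       f_rem (2 * n - 1) ` {0<..1/2} = {a_coeff (2 * n) <.. A_const (2 * n - 1)} \<and>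
       strict_antimono_on {0<..1/2} (f_rem (2 * n)) \<and>
       convex_on {0<..1/2} (f_rem (2 * n)) \<and>
       f_rem (2 * n) ` {0<..1/2} = {A_const (2 * n) ..< a_coeff (2 * n + 1)})
    \<and>
    (\<forall>n\<ge>1. \<forall>x\<in>{0<..1/2}.
       (let L = (B_fun x + R_poly (2 * n + 2) x + A_const (2 * n + 2) * x ^ (2 * n + 3))
                  / (1 + x * (1 - x));
            U = (B_fun x + R_poly (2 * n + 1) x + A_const (2 * n + 1) * x ^ (2 * (n + 1)))
                  / (1 + x * (1 - x))
        in L \<le> R_fun x \<and> R_fun x \<le> U \<and>
           (L = R_fun x \<longleftrightarrow> x = 1/2) \<and> (R_fun x = U \<longleftrightarrow> x = 1/2)))
    \<and>
    (\<forall>x\<in>{0<..1/2}.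
       (let L = (B_fun x + R_poly 4 x + A_const 4 * x ^ 5) / (1 + x * (1 - x));
            U = (B_fun x + R_poly 3 x + A_const 3 * x ^ 4) / (1 + x * (1 - x))
        in L \<le> R_fun x \<and> R_fun x \<le> U \<and>
           (L = R_fun x \<longleftrightarrow> x = 1/2) \<and> (R_fun x = U \<longleftrightarrow> x = 1/2)))
    \<and>
    (\<forall>n.
       strict_mono_on {0<..<1/2} (g_rem n) \<and> concave_on {0<..<1/2} (g_rem n) \<and>
       g_rem n ` {0<..<1/2} = {c_const n <..< b_coeff (n + 1)})
    \<and>
    (\<forall>m n. strictly_completely_monotonic_on {0<..<1/2} (G_fun n m))
    \<and>
    (\<forall>n. \<forall>x\<in>{0<..1/2}.
       (let L = (B_fun x + S_poly (n + 1) x + c_const (n + 1) * (1 - 2 * x) ^ (2 * n + 3))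
                  / (1 + x * (1 - x));
            U = (B_fun x + S_poly (n + 1) x) / (1 + x * (1 - x))
        in L \<le> R_fun x \<and> R_fun x \<le> U \<and>
           (L = R_fun x \<longleftrightarrow> x = 1/2) \<and> (R_fun x = U \<longleftrightarrow> x = 1/2)))
    \<and>
    (\<forall>x\<in>{0<..1/2}.
       (let L = (B_fun x + S_poly 2 x + c_const 2 * (1 - 2 * x) ^ 5) / (1 + x * (1 - x));
            U = (B_fun x + S_poly 2 x) / (1 + x * (1 - x))
        in L \<le> R_fun x \<and> R_fun x \<le> U \<and>
           (L = R_fun x \<longleftrightarrow> x = 1/2) \<and> (R_fun x = U \<longleftrightarrow> x = 1/2)))"
proof (intro conjI allI impI ballI)
  show "strict_mono_on {0<..1/2} (f_rem 0)"
    by (intro strict_mono_onI f_rem_0_strict_mono) auto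
next
  fix n :: nat and x :: real
  assume "1 \<le> n" and x: "x \<in> {0<..1/2}"
  then have "2 * n + 1 + 1 = 2 * (n + 1)" "2 * n + 2 + 1 = 2 * n + 3"
    by auto
  then show "let L = (B_fun x + R_poly (2 * n + 2) x + A_const (2 * n + 2) * x ^ (2 * n + 3)) / (1 + x * (1 - x));
            U = (B_fun x + R_poly (2 * n + 1) x + A_const (2 * n + 1) * x ^ (2 * (n + 1))) / (1 + x * (1 - x))
        in L \<le> R_fun x \<and> R_fun x \<le> U \<and> (L = R_fun x \<longleftrightarrow> x = 1/2) \<and> (R_fun x = U \<longleftrightarrow> x = 1/2)"
    using R_fun_bounds_Taylor[of x "2 * n + 2" "2 * n + 1"] x by (simp only:) simp
next
  fix x :: real assume x: "x \<in> {0<..1/2}"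
  show "let L = (B_fun x + R_poly 4 x + A_const 4 * x ^ 5) / (1 + x * (1 - x));
            U = (B_fun x + R_poly 3 x + A_const 3 * x ^ 4) / (1 + x * (1 - x))
        in L \<le> R_fun x \<and> R_fun x \<le> U \<and> (L = R_fun x \<longleftrightarrow> x = 1/2) \<and> (R_fun x = U \<longleftrightarrow> x = 1/2)"
    using R_fun_bounds_Taylor[of x 4 3] x by simp
next
  fix x :: real assume x: "x \<in> {0<..1/2}"
  show "let L = (B_fun x + S_poly 2 x + c_const 2 * (1 - 2 * x) ^ 5) / (1 + x * (1 - x));
            U = (B_fun x + S_poly 2 x) / (1 + x * (1 - x))
        in L \<le> R_fun x \<and> R_fun x \<le> U \<and> (L = R_fun x \<longleftrightarrow> x = 1/2) \<and> (R_fun x = U \<longleftrightarrow> x = 1/2)"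
  proof -
    have "1 + 1 = (2::nat)" "2 * 1 + 3 = (5::nat)"
      by auto
    then show ?thesis
      using R_fun_bounds_midpoint[of x 1] x by (simp only:) simp
  qed
next
  fix n :: nat assume n: "1 \<le> n"
  then have o: "odd (2 * n - 1)" and e: "2 * n - 1 + 1 = 2 * n"
    by auto
  show "f_rem (2 * n - 1) ` {0<..1/2} = {a_coeff (2 * n)<..A_const (2 * n - 1)}"
    using f_rem_odd_image[OF o] unfolding e .
  show "f_rem (2 * n) ` {0<..1/2} = {A_const (2 * n)..<a_coeff (2 * n + 1)}"
    using n by (intro f_rem_even_image) auto
  show "strict_mono_on {0<..1/2} (f_rem (2 * n - 1))" "concave_on {0<..1/2} (f_rem (2 * n - 1))"
    by (rule f_rem_odd_strict_mono[OF o], rule f_rem_odd_concave[OF o])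
  show "strict_antimono_on {0<..1/2} (f_rem (2 * n))" "convex_on {0<..1/2} (f_rem (2 * n))"
    using n by (auto intro!: f_rem_even_strict_antimono f_rem_even_convex)
qed (use R_fun_bounds_midpoint in \<open>auto simp: f_rem_0_convex f_rem_0_image g_rem_strict_mono g_rem_concave
    g_rem_image G_fun_strictly_completely_monotonic\<close>)

end
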